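(* Let $-A$ be the generator of a compact analytic $C_0$-semigroup $\{e^{-At}\}_{t\ge 0}$ on $L^2(\Omega)$, let $B:L^2(\Omega)\to L^2(\Omega)$ be bounded and Lipschitz, let $r:C([-h,0];L^2(\Omega))\to[0,h]$ be Lipschitz, and set $F(\varphi)=B(\varphi(-r(\varphi)))$ for $\varphi\in C([-h,0];L^2(\Omega))$. Then for every $\varphi\in X=\{\varphi\in C^1([-h,0];L^2(\Omega)) : \varphi(0)\in D(A)\}$ there is $t_\varphi>0$ such that the initial value problem $$\frac{du(t)}{dt}+Au(t)=F(u_t),\quad t>0,\qquad u_0=u|_{[-h,0]}=\varphi,$$ has a unique classical solution for $t\in[0,t_\varphi)$.
   Context: $\Omega\subset\mathbb{R}^n$ is a domain, $h>0$ is fixed, and $C=C([-h,0];L^2(\Omega))$ carries the sup-norm. For a continuous $u:[-h,T)\to L^2(\Omega)$ and $t\in[0,T)$, $u_t\in C$ is defined by $u_t(\theta)=u(t+\theta)$, $\theta\in[-h,0]$. A compact semigroup is one with $e^{-At}$ compact for $t>0$. "Bounded" for the (possibly nonlinear) operator $B$ means that it maps bounded sets to bounded sets. A classical solution on $[-h,T)$ of the initial value problem is a function $u\in C([-h,T);L^2(\Omega))\cap C^1((0,T);L^2(\Omega))$ such that $u|_{[-h,0]}=\varphi$, $u(t)\in D(A)$ for $0<t<T$, and the differential equation is satisfied on $(0,T)$. *)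

theory Defs
  imports "HOL-Analysis.Analysis"
begin

section \<open>The space of square integrable functions\<close>

definition square_integrable :: "('a::euclidean_space \<Rightarrow> complex) \<Rightarrow> bool" where
  "square_integrable f \<longleftrightarrow>
     f \<in> borel_measurable lebesgue \<and> integrable lebesgue (\<lambda>x. (cmod (f x))\<^sup>2)"

definition l2_eq :: "('a::euclidean_space \<Rightarrow> complex) \<Rightarrow> ('a \<Rightarrow> complex) \<Rightarrow> bool" where
  "l2_eq f g \<longleftrightarrow>
     square_integrable f \<and> square_integrable g \<and> (AE x in lebesgue. f x = g x)"

lemma square_integrable_zero [simp]: "square_integrable (\<lambda>x. 0)"
  by (simp add: square_integrable_def)

lemma square_integrable_add:
  assumes "square_integrable f" "square_integrable g"
  shows "square_integrable (\<lambda>x. f x + g x)"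
proof -
  have [measurable]: "f \<in> borel_measurable lebesgue" "g \<in> borel_measurable lebesgue"
    and fg: "integrable lebesgue (\<lambda>x. (cmod (f x))\<^sup>2)" "integrable lebesgue (\<lambda>x. (cmod (g x))\<^sup>2)"
    using assms by (auto simp: square_integrable_def)
  have bound: "(cmod (a + b))\<^sup>2 \<le> 2 * (cmod a)\<^sup>2 + 2 * (cmod b)\<^sup>2" for a b
  proof -
    have "(cmod (a + b))\<^sup>2 \<le> (cmod a + cmod b)\<^sup>2"
      by (intro power_mono norm_triangle_ineq norm_ge_zero)
    also have "\<dots> \<le> 2 * (cmod a)\<^sup>2 + 2 * (cmod b)\<^sup>2"
      using zero_le_power2[of "cmod a - cmod b"] by (simp add: power2_eq_square algebra_simps)
    finally show ?thesis .
  qed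
  have "integrable lebesgue (\<lambda>x. (cmod (f x + g x))\<^sup>2)"
  proof (rule Bochner_Integration.integrable_bound)
    show "integrable lebesgue (\<lambda>x. 2 * (cmod (f x))\<^sup>2 + 2 * (cmod (g x))\<^sup>2)"
      using fg by simp
    show "AE x in lebesgue. norm ((cmod (f x + g x))\<^sup>2)
            \<le> norm (2 * (cmod (f x))\<^sup>2 + 2 * (cmod (g x))\<^sup>2)"
      using bound by (intro AE_I2) auto
  qed measurable
  then show ?thesis
    by (simp add: square_integrable_def)
qed

lemma square_integrable_scale:
  assumes "square_integrable f"
  shows "square_integrable (\<lambda>x. c * f x)"
  using assms by (auto simp: square_integrable_def norm_mult power_mult_distrib)

lemma integrable_inner_square_integrable:
  fixes f g :: "'a::euclidean_space \<Rightarrow> complex"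
  assumes "square_integrable f" "square_integrable g"
  shows "integrable lebesgue (\<lambda>x. f x \<bullet> g x)"
proof (rule Bochner_Integration.integrable_bound)
  have [measurable]: "f \<in> borel_measurable lebesgue" "g \<in> borel_measurable lebesgue"
    using assms by (auto simp: square_integrable_def)
  show "(\<lambda>x. f x \<bullet> g x) \<in> borel_measurable lebesgue" by measurable
  show "integrable lebesgue (\<lambda>x. (cmod (f x))\<^sup>2 + (cmod (g x))\<^sup>2)"
    using assms by (auto simp: square_integrable_def)
  have bound: "\<bar>a \<bullet> b\<bar> \<le> (cmod a)\<^sup>2 + (cmod b)\<^sup>2" for a b :: complex
  proof -
    have "\<bar>a \<bullet> b\<bar> \<le> cmod a * cmod b" by (rule Cauchy_Schwarz_ineq2)
    also have "\<dots> \<le> (cmod a)\<^sup>2 + (cmod b)\<^sup>2"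
      using zero_le_power2[of "cmod a - cmod b"] mult_nonneg_nonneg[of "cmod a" "cmod b"]
      by (simp add: power2_eq_square algebra_simps del: mult_nonneg_nonneg zero_le_mult_iff)
    finally show ?thesis .
  qed
  show "AE x in lebesgue. norm (f x \<bullet> g x) \<le> norm ((cmod (f x))\<^sup>2 + (cmod (g x))\<^sup>2)"
    using bound by (intro AE_I2) auto
qed

quotient_type (overloaded) 'a l2 = "'a::euclidean_space \<Rightarrow> complex" / partial: l2_eq
proof (rule part_equivpI)
  show "\<exists>f :: 'a \<Rightarrow> complex. l2_eq f f"
    by (rule exI[of _ "\<lambda>x. 0"]) (simp add: l2_eq_def)
  show "symp (l2_eq :: ('a \<Rightarrow> complex) \<Rightarrow> _)"
    by (auto simp: symp_def l2_eq_def elim: eventually_mono)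
  show "transp (l2_eq :: ('a \<Rightarrow> complex) \<Rightarrow> _)"
    unfolding transp_def l2_eq_def by (auto elim: eventually_elim2)
qed

instantiation l2 :: (euclidean_space) real_vector
begin

lift_definition zero_l2 :: "'a l2" is "\<lambda>x. 0"
  by (simp add: l2_eq_def)

lift_definition plus_l2 :: "'a l2 \<Rightarrow> 'a l2 \<Rightarrow> 'a l2" is "\<lambda>f g x. f x + g x"
  unfolding l2_eq_def by (auto intro: square_integrable_add elim: eventually_elim2)

lift_definition uminus_l2 :: "'a l2 \<Rightarrow> 'a l2" is "\<lambda>f x. - f x"
  unfolding l2_eq_def using square_integrable_scale[of _ "-1"]
  by (auto elim: eventually_mono)

definition minus_l2 :: "'a l2 \<Rightarrow> 'a l2 \<Rightarrow> 'a l2" where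
  "minus_l2 u v = u + - v"

lift_definition scaleR_l2 :: "real \<Rightarrow> 'a l2 \<Rightarrow> 'a l2" is "\<lambda>a f x. of_real a * f x"
  unfolding l2_eq_def by (auto intro: square_integrable_scale elim: eventually_mono)

instance
proof
  fix a b :: real and u v w :: "'a l2"
  show "u + v + w = u + (v + w)"
    by transfer (auto simp: l2_eq_def add.assoc intro!: square_integrable_add)
  show "u + v = v + u"
    by transfer (auto simp: l2_eq_def add.commute intro!: square_integrable_add)
  show "0 + u = u"
    by transfer (auto simp: l2_eq_def)
  show "- u + u = 0"
    by transfer (auto simp: l2_eq_def)
  show "u - v = u + - v"
    by (simp add: minus_l2_def)
  show "a *\<^sub>R (u + v) = a *\<^sub>R u + a *\<^sub>R v"
    by transfer (auto simp: l2_eq_def distrib_left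
        intro!: square_integrable_add square_integrable_scale)
  show "(a + b) *\<^sub>R u = a *\<^sub>R u + b *\<^sub>R u"
    by transfer (auto simp: l2_eq_def distrib_right
        intro!: square_integrable_add square_integrable_scale)
  show "a *\<^sub>R b *\<^sub>R u = (a * b) *\<^sub>R u"
    by transfer (auto simp: l2_eq_def mult.assoc intro!: square_integrable_scale)
  show "1 *\<^sub>R u = u"
    by transfer (auto simp: l2_eq_def)
qed

end

instantiation l2 :: (euclidean_space) real_inner
begin

lift_definition inner_l2 :: "'a l2 \<Rightarrow> 'a l2 \<Rightarrow> real" is "\<lambda>f g. \<integral>x. f x \<bullet> g x \<partial>lebesgue"
  by (rule integral_cong_AE) (auto simp: l2_eq_def square_integrable_def elim: eventually_elim2)

lift_definition norm_l2 :: "'a l2 \<Rightarrow> real" is "\<lambda>f. sqrt (\<integral>x. (cmod (f x))\<^sup>2 \<partial>lebesgue)"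
  by (intro arg_cong[of _ _ sqrt] integral_cong_AE)
    (auto simp: l2_eq_def square_integrable_def elim: eventually_mono)

definition dist_l2 :: "'a l2 \<Rightarrow> 'a l2 \<Rightarrow> real" where
  "dist_l2 u v = norm (u - v)"

definition sgn_l2 :: "'a l2 \<Rightarrow> 'a l2" where
  "sgn_l2 u = u /\<^sub>R norm u"

definition uniformity_l2 :: "('a l2 \<times> 'a l2) filter" where
  "uniformity_l2 = (INF e\<in>{0<..}. principal {(u, v). dist u v < e})"

definition open_l2 :: "'a l2 set \<Rightarrow> bool" where
  "open_l2 U \<longleftrightarrow> (\<forall>u\<in>U. \<forall>\<^sub>F (u', v) in uniformity. u' = u \<longrightarrow> v \<in> U)"

instance
proof
  fix a :: real and u v w :: "'a l2"
  show "dist u v = norm (u - v)" by (simp add: dist_l2_def)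
  show "sgn u = u /\<^sub>R norm u" by (simp add: sgn_l2_def)
  show "uniformity = (INF e\<in>{0<..}. principal {(u, v :: 'a l2). dist u v < e})"
    by (simp add: uniformity_l2_def)
  show "open U \<longleftrightarrow> (\<forall>u\<in>U. \<forall>\<^sub>F (u', v) in uniformity. u' = u \<longrightarrow> v \<in> U)" for U :: "'a l2 set"
    by (simp add: open_l2_def)
  show "u \<bullet> v = v \<bullet> u"
    by transfer (simp add: inner_commute)
  show "(u + v) \<bullet> w = u \<bullet> w + v \<bullet> w"
    by transfer (auto simp: l2_eq_def inner_add_left integrable_inner_square_integrable)
  show "(a *\<^sub>R u) \<bullet> v = a * (u \<bullet> v)"
    by transfer (simp add: scaleR_conv_of_real[symmetric])
  show "0 \<le> u \<bullet> u"
    by transfer simp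
  show "u \<bullet> u = 0 \<longleftrightarrow> u = 0"
  proof transfer
    fix f :: "'a \<Rightarrow> complex"
    assume "l2_eq f f"
    then have sf: "square_integrable f" by (simp add: l2_eq_def)
    have "(\<integral>x. f x \<bullet> f x \<partial>lebesgue) = 0 \<longleftrightarrow> (AE x in lebesgue. f x \<bullet> f x = 0)"
      by (rule integral_nonneg_eq_0_iff_AE[OF integrable_inner_square_integrable[OF sf sf]]) simp
    then show "(\<integral>x. f x \<bullet> f x \<partial>lebesgue) = 0 \<longleftrightarrow> l2_eq f (\<lambda>x. 0)"
      using sf by (simp add: l2_eq_def)
  qed
  show "norm u = sqrt (u \<bullet> u)"
    by transfer (simp add: power2_norm_eq_inner)
qed

end

lemma norm_l2_abs:
  assumes "square_integrable f"
  shows "norm (abs_l2 f) = sqrt (\<integral>x. (cmod (f x))\<^sup>2 \<partial>lebesgue)"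
  using assms by (simp add: norm_l2.abs_eq l2_eq_def)

lemma l2_cases:
  obtains f where "square_integrable f" "u = abs_l2 f"
  using Quotient3_rep_reflp[OF Quotient3_l2, of u] Quotient3_abs_rep[OF Quotient3_l2, of u]
  unfolding l2_eq_def by metis

lemma diff_l2_abs:
  assumes "square_integrable f" "square_integrable g"
  shows "abs_l2 f - abs_l2 g = abs_l2 (\<lambda>x. f x - g x)"
    and "square_integrable (\<lambda>x. f x - g x)"
proof -
  have g: "square_integrable (\<lambda>x. - g x)"
    using square_integrable_scale[OF assms(2), of "-1"] by simp
  show "abs_l2 f - abs_l2 g = abs_l2 (\<lambda>x. f x - g x)"
    using assms g by (simp add: minus_l2_def uminus_l2.abs_eq plus_l2.abs_eq l2_eq_def)
  show "square_integrable (\<lambda>x. f x - g x)"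
    using square_integrable_add[OF assms(1) g] by simp
qed

lemma nn_integral_square_integrable:
  assumes "square_integrable f"
  shows "(\<integral>\<^sup>+x. ennreal ((cmod (f x))\<^sup>2) \<partial>lebesgue) = ennreal ((norm (abs_l2 f))\<^sup>2)"
  using assms unfolding norm_l2_abs[OF assms]
  by (subst nn_integral_eq_integral) (auto simp: square_integrable_def)

lemma convergent_if_weighted_square_summable:
  fixes z :: "nat \<Rightarrow> complex"
  assumes "summable (\<lambda>n. 2 ^ n * (cmod (z (Suc n) - z n))\<^sup>2)"
  shows "convergent z"
proof -
  let ?a = "\<lambda>n. cmod (z (Suc n) - z n)"
  have "summable (\<lambda>n. (1/2) ^ n + 2 ^ n * (?a n)\<^sup>2)"
    using assms by (intro summable_add summable_geometric) auto
  then have "summable (\<lambda>n. z (Suc n) - z n)"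
  proof (rule summable_comparison_test'[where N = 0])
    fix n :: nat
    have p: "(2::real) ^ n * (1/2) ^ n = 1"
      by (simp add: power_mult_distrib[symmetric])
    show "norm (z (Suc n) - z n) \<le> (1/2) ^ n + 2 ^ n * (?a n)\<^sup>2"
    proof (cases "?a n \<le> (1/2) ^ n")
      case True
      then show ?thesis by (simp add: add_increasing2)
    next
      case False
      then have "2 ^ n * ?a n * (1/2) ^ n \<le> 2 ^ n * ?a n * ?a n"
        by (intro mult_left_mono) auto
      also have "2 ^ n * ?a n * (1/2) ^ n = ?a n"
        using p by (simp add: mult.commute mult.left_commute)
      finally have "?a n \<le> 2 ^ n * (?a n)\<^sup>2"
        by (simp add: power2_eq_square mult.assoc)
      then show ?thesis by (simp add: add_increasing)
    qed
  qed
  then have "convergent (\<lambda>n. \<Sum>i<n. z (Suc i) - z i)"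
    by (simp add: summable_iff_convergent)
  then have "convergent (\<lambda>n. z n - z 0)"
    by (simp add: sum_lessThan_telescope)
  then have "convergent (\<lambda>n. (z n - z 0) + z 0)"
    by (rule convergent_add) (rule convergent_const)
  then show ?thesis by simp
qed

lemma convergent_l2_if_fast_Cauchy:
  fixes Y :: "nat \<Rightarrow> 'a::euclidean_space l2"
  assumes Y: "\<And>n m. n \<le> m \<Longrightarrow> norm (Y m - Y n) \<le> (1/2) ^ n"
  shows "convergent Y"
proof -
  have "\<forall>n. \<exists>f. square_integrable f \<and> Y n = abs_l2 f"
    by (metis l2_cases)
  then obtain f where sf: "\<And>n. square_integrable (f n)" and Yf: "\<And>n. Y n = abs_l2 (f n)"
    by metis
  have [measurable]: "f n \<in> borel_measurable lebesgue" for n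
    using sf by (simp add: square_integrable_def)
  have nnf: "(\<integral>\<^sup>+x. ennreal ((cmod (f m x - f n x))\<^sup>2) \<partial>lebesgue) \<le> ennreal (((1/2) ^ n)\<^sup>2)"
    if "n \<le> m" for m n
  proof -
    have "(norm (Y m - Y n))\<^sup>2 \<le> ((1/2) ^ n)\<^sup>2"
      using Y[OF that] by (intro power_mono) auto
    then show ?thesis
      using nn_integral_square_integrable[OF diff_l2_abs(2)[OF sf[of m] sf[of n]]]
      by (simp add: Yf diff_l2_abs(1)[OF sf sf] ennreal_leI)
  qed
  define a where "a n x = 2 ^ n * (cmod (f (Suc n) x - f n x))\<^sup>2" for n x
  have a_nonneg: "0 \<le> a n x" for n x by (simp add: a_def)
  have [measurable]: "a n \<in> borel_measurable lebesgue" for n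
    unfolding a_def by measurable
  have int_a: "(\<integral>\<^sup>+x. ennreal (a n x) \<partial>lebesgue) \<le> ennreal ((1/2) ^ n)" for n
  proof -
    have "(\<integral>\<^sup>+x. ennreal (a n x) \<partial>lebesgue)
        = ennreal (2 ^ n) * (\<integral>\<^sup>+x. ennreal ((cmod (f (Suc n) x - f n x))\<^sup>2) \<partial>lebesgue)"
      unfolding a_def by (subst nn_integral_cmult[symmetric]) (auto simp: ennreal_mult)
    also have "\<dots> \<le> ennreal (2 ^ n) * ennreal (((1/2) ^ n)\<^sup>2)"
      by (intro mult_left_mono nnf) auto
    also have "\<dots> = ennreal ((1/2) ^ n)"
      by (simp add: ennreal_mult[symmetric] power2_eq_square power_divide)
    finally show ?thesis .
  qed
  have "(\<integral>\<^sup>+x. (\<Sum>n. ennreal (a n x)) \<partial>lebesgue) = (\<Sum>n. \<integral>\<^sup>+x. ennreal (a n x) \<partial>lebesgue)"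
    by (rule nn_integral_suminf) measurable
  also have "\<dots> \<le> (\<Sum>n. ennreal ((1/2) ^ n))"
    by (intro suminf_le int_a) auto
  also have "\<dots> = ennreal (\<Sum>n. (1/2) ^ n)"
    by (intro suminf_ennreal2) (auto intro: summable_geometric)
  finally have "(\<integral>\<^sup>+x. (\<Sum>n. ennreal (a n x)) \<partial>lebesgue) \<noteq> \<infinity>"
    by (auto simp: top_unique)
  then have "AE x in lebesgue. (\<Sum>n. ennreal (a n x)) \<noteq> \<infinity>"
    by (intro nn_integral_noteq_infinite) measurable
  then have ae: "AE x in lebesgue. convergent (\<lambda>n. f n x)"
  proof eventually_elim
    case (elim x)
    then have "summable (\<lambda>n. a n x)"
      using a_nonneg by (intro summable_suminf_not_top) auto
    then show ?case
      unfolding a_def by (rule convergent_if_weighted_square_summable)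
  qed
  define g where "g x = lim (\<lambda>n. f n x)" for x
  have [measurable]: "g \<in> borel_measurable lebesgue"
    unfolding g_def by measurable
  have gf: "(\<integral>\<^sup>+x. ennreal ((cmod (g x - f n x))\<^sup>2) \<partial>lebesgue) \<le> ennreal (((1/2) ^ n)\<^sup>2)" for n
  proof -
    have "(\<integral>\<^sup>+x. ennreal ((cmod (g x - f n x))\<^sup>2) \<partial>lebesgue)
        = (\<integral>\<^sup>+x. liminf (\<lambda>m. ennreal ((cmod (f m x - f n x))\<^sup>2)) \<partial>lebesgue)"
    proof (rule nn_integral_cong_AE)
      show "AE x in lebesgue. ennreal ((cmod (g x - f n x))\<^sup>2)
              = liminf (\<lambda>m. ennreal ((cmod (f m x - f n x))\<^sup>2))"
        using ae
      proof eventually_elim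
        case (elim x)
        then have "(\<lambda>m. f m x) \<longlonglongrightarrow> g x"
          by (simp add: g_def convergent_LIMSEQ_iff)
        then have "(\<lambda>m. ennreal ((cmod (f m x - f n x))\<^sup>2)) \<longlonglongrightarrow> ennreal ((cmod (g x - f n x))\<^sup>2)"
          by (intro tendsto_ennrealI tendsto_intros)
        then show ?case
          by (intro lim_imp_Liminf[symmetric]) auto
      qed
    qed
    also have "\<dots> \<le> liminf (\<lambda>m. \<integral>\<^sup>+x. ennreal ((cmod (f m x - f n x))\<^sup>2) \<partial>lebesgue)"
      by (intro nn_integral_liminf) measurable
    also have "\<dots> \<le> liminf (\<lambda>m. ennreal (((1/2) ^ n)\<^sup>2))"
      using nnf by (intro Liminf_mono) (auto simp: eventually_sequentially)
    finally show ?thesis by (simp add: Liminf_const)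
  qed
  have sd: "square_integrable (\<lambda>x. g x - f n x)" for n
    unfolding square_integrable_def
  proof
    show "integrable lebesgue (\<lambda>x. (cmod (g x - f n x))\<^sup>2)"
      using gf[of n] by (intro integrableI_bounded) (auto intro: le_less_trans)
  qed measurable
  have sg: "square_integrable g"
    using square_integrable_add[OF sd[of 0] sf[of 0]] by simp
  have le: "norm (Y n - abs_l2 g) \<le> (1/2) ^ n" for n
  proof -
    have "ennreal ((norm (abs_l2 g - Y n))\<^sup>2) \<le> ennreal (((1/2) ^ n)\<^sup>2)"
      using gf[of n] nn_integral_square_integrable[OF sd[of n]]
      by (simp add: Yf diff_l2_abs(1)[OF sg sf])
    then have "(norm (abs_l2 g - Y n))\<^sup>2 \<le> ((1/2) ^ n)\<^sup>2"
      by (subst (asm) ennreal_le_iff) auto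
    then show ?thesis
      by (subst norm_minus_commute) (auto intro: power2_le_imp_le)
  qed
  have "(\<lambda>n. Y n - abs_l2 g) \<longlonglongrightarrow> 0"
    by (rule Lim_null_comparison[OF always_eventually[rule_format, OF le]])
      (simp add: LIMSEQ_power_zero)
  then have "Y \<longlonglongrightarrow> abs_l2 g"
    by (simp add: LIM_zero_iff)
  then show ?thesis
    by (rule convergentI)
qed

instance l2 :: (euclidean_space) complete_space
proof
  fix X :: "nat \<Rightarrow> 'a l2"
  assume X: "Cauchy X"
  have "\<exists>N. \<forall>m\<ge>N. \<forall>n\<ge>N. norm (X m - X n) < (1/2) ^ k" for k
    using X by (simp add: Cauchy_iff)
  then obtain N where N: "\<And>k m n. N k \<le> m \<Longrightarrow> N k \<le> n \<Longrightarrow> norm (X m - X n) < (1/2) ^ k"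
    by metis
  define r where "r k = k + (\<Sum>i\<le>k. N i)" for k
  have r: "strict_mono r"
    by (rule strict_monoI_Suc) (simp add: r_def)
  have Nr: "N k \<le> r k" for k
    using member_le_sum[of k "{..k}" N] by (simp add: r_def trans_le_add2)
  have "convergent (X \<circ> r)"
  proof (rule convergent_l2_if_fast_Cauchy)
    fix n m :: nat
    assume "n \<le> m"
    then have "r n \<le> r m"
      using r by (simp add: strict_mono_less_eq)
    then show "norm ((X \<circ> r) m - (X \<circ> r) n) \<le> (1/2) ^ n"
      using N[of n "r m" "r n"] Nr[of n] by simp
  qed
  then show "convergent X"
    using Cauchy_converges_subseq[OF X r] by (auto simp: convergent_def)
qed

lift_definition scaleC_l2 :: "complex \<Rightarrow> 'a::euclidean_space l2 \<Rightarrow> 'a l2" (infixr "*\<^sub>C" 75)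
  is "\<lambda>c f x. c * f x"
  unfolding l2_eq_def by (auto intro: square_integrable_scale elim: eventually_mono)

lift_definition vanishes_off :: "'a::euclidean_space set \<Rightarrow> 'a l2 \<Rightarrow> bool"
  is "\<lambda>\<Omega> f. AE x in lebesgue. x \<notin> \<Omega> \<longrightarrow> f x = 0"
  by (intro iffI; unfold l2_eq_def; auto elim: eventually_elim2)

lift_definition real_valued :: "'a::euclidean_space l2 \<Rightarrow> bool"
  is "\<lambda>f. AE x in lebesgue. f x \<in> \<real>"
  by (intro iffI; unfold l2_eq_def; auto elim: eventually_elim2)

text \<open>
  A type cannot depend on the set \<open>\<Omega>\<close>, so \<open>L\<^sup>2(\<Omega>)\<close> is realised, isometrically and
  through extension by zero, as a closed subspace of the square integrable functions on the
  whole space. Real and complex scalars are both provided.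
\<close>

definition L2_complex :: "'a::euclidean_space set \<Rightarrow> 'a l2 set" where
  "L2_complex \<Omega> = {u. vanishes_off \<Omega> u}"

definition L2_real :: "'a::euclidean_space set \<Rightarrow> 'a l2 set" where
  "L2_real \<Omega> = {u. vanishes_off \<Omega> u \<and> real_valued u}"


section \<open>Semigroups\<close>

text \<open>
  In this section \<open>H\<close> is a closed real subspace, and operators on \<open>H\<close> are functions
  whose values outside \<open>H\<close> are irrelevant.
\<close>

definition bounded_linear_on :: "'b::real_normed_vector set \<Rightarrow> ('b \<Rightarrow> 'b) \<Rightarrow> bool" where
  "bounded_linear_on H S \<longleftrightarrow>
     S ` H \<subseteq> H \<and>
     (\<forall>x\<in>H. \<forall>y\<in>H. S (x + y) = S x + S y) \<and>
     (\<forall>a. \<forall>x\<in>H. S (a *\<^sub>R x) = a *\<^sub>R S x) \<and>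
     (\<exists>K. \<forall>x\<in>H. norm (S x) \<le> K * norm x)"

definition C0_semigroup_on :: "'b::real_normed_vector set \<Rightarrow> (real \<Rightarrow> 'b \<Rightarrow> 'b) \<Rightarrow> bool" where
  "C0_semigroup_on H T \<longleftrightarrow>
     (\<forall>t\<ge>0. bounded_linear_on H (T t)) \<and>
     (\<forall>x\<in>H. T 0 x = x) \<and>
     (\<forall>s\<ge>0. \<forall>t\<ge>0. \<forall>x\<in>H. T (s + t) x = T s (T t x)) \<and>
     (\<forall>x\<in>H. ((\<lambda>t. T t x) \<longlongrightarrow> x) (at_right 0))"

definition generator_domain :: "'b::real_normed_vector set \<Rightarrow> (real \<Rightarrow> 'b \<Rightarrow> 'b) \<Rightarrow> 'b set" where
  "generator_domain H T = {x \<in> H. \<exists>y. ((\<lambda>t. (T t x - x) /\<^sub>R t) \<longlongrightarrow> y) (at_right 0)}"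

definition is_generator ::
  "'b::real_normed_vector set \<Rightarrow> (real \<Rightarrow> 'b \<Rightarrow> 'b) \<Rightarrow> 'b set \<Rightarrow> ('b \<Rightarrow> 'b) \<Rightarrow> bool" where
  "is_generator H T D G \<longleftrightarrow>
     D = generator_domain H T \<and>
     (\<forall>x\<in>D. ((\<lambda>t. (T t x - x) /\<^sub>R t) \<longlongrightarrow> G x) (at_right 0))"

definition compact_operator_on :: "'b::real_normed_vector set \<Rightarrow> ('b \<Rightarrow> 'b) \<Rightarrow> bool" where
  "compact_operator_on H S \<longleftrightarrow> (\<forall>M\<subseteq>H. bounded M \<longrightarrow> compact (closure (S ` M)))"

definition compact_semigroup_on :: "'b::real_normed_vector set \<Rightarrow> (real \<Rightarrow> 'b \<Rightarrow> 'b) \<Rightarrow> bool" where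
  "compact_semigroup_on H T \<longleftrightarrow> (\<forall>t>0. compact_operator_on H (T t))"

definition sector :: "real \<Rightarrow> complex set" where
  "sector \<theta> = {z. z \<noteq> 0 \<and> \<bar>Arg z\<bar> < \<theta>}"

definition complex_hull :: "'a::euclidean_space l2 set \<Rightarrow> 'a l2 set" where
  "complex_hull H = {x + \<i> *\<^sub>C y | x y. x \<in> H \<and> y \<in> H}"

text \<open>
  Analyticity of a semigroup refers to complex scalars. For \<open>H = L2_complex \<Omega>\<close> the complex
  hull is \<open>H\<close> itself; for \<open>H = L2_real \<Omega>\<close> it is the complexification \<open>L2_complex \<Omega>\<close>,
  and the extension of \<open>T\<close> to it is the complex linear one. The Frechet derivative
  below has the form \<open>h \<mapsto> h *\<^sub>C d\<close>, that is, it is a complex derivative.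
\<close>

definition analytic_semigroup_on ::
  "'a::euclidean_space l2 set \<Rightarrow> (real \<Rightarrow> 'a l2 \<Rightarrow> 'a l2) \<Rightarrow> bool" where
  "analytic_semigroup_on H T \<longleftrightarrow>
     (\<exists>\<theta> S. 0 < \<theta> \<and> \<theta> \<le> pi / 2 \<and>
        (\<forall>t\<ge>0. \<forall>x\<in>H. S (complex_of_real t) x = T t x) \<and>
        (\<forall>z\<in>insert 0 (sector \<theta>). bounded_linear_on (complex_hull H) (S z) \<and>
           (\<forall>c. \<forall>x\<in>complex_hull H. S z (c *\<^sub>C x) = c *\<^sub>C S z x)) \<and>
        (\<forall>x\<in>complex_hull H. S 0 x = x) \<and>
        (\<forall>z\<in>insert 0 (sector \<theta>). \<forall>w\<in>insert 0 (sector \<theta>). \<forall>x\<in>complex_hull H.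
           S (z + w) x = S z (S w x)) \<and>
        (\<forall>x\<in>complex_hull H. \<forall>z\<in>sector \<theta>. \<exists>d.
           ((\<lambda>w. S w x) has_derivative (\<lambda>h. h *\<^sub>C d)) (at z)) \<and>
        (\<forall>x\<in>complex_hull H. ((\<lambda>z. S z x) \<longlongrightarrow> x) (at 0 within sector \<theta>)))"


section \<open>The delay equation\<close>

text \<open>
  Elements of \<open>C([-h,0];H)\<close> are represented by functions on the real line whose values
  outside \<open>[-h,0]\<close> are irrelevant. A functional that is Lipschitz for \<open>sup_norm\<close> depends only
  on the restriction to \<open>[-h,0]\<close>.
\<close>

definition C_space :: "real \<Rightarrow> 'b::real_normed_vector set \<Rightarrow> (real \<Rightarrow> 'b) set" where
  "C_space h H = {\<phi>. continuous_on {-h..0} \<phi> \<and> \<phi> ` {-h..0} \<subseteq> H}"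

definition sup_norm :: "real \<Rightarrow> (real \<Rightarrow> 'b::real_normed_vector) \<Rightarrow> real" where
  "sup_norm h \<phi> = (SUP s\<in>{-h..0}. norm (\<phi> s))"

definition C1_space :: "real \<Rightarrow> 'b::real_normed_vector set \<Rightarrow> (real \<Rightarrow> 'b) set" where
  "C1_space h H = {\<phi> \<in> C_space h H.
     \<exists>\<phi>'. continuous_on {-h..0} \<phi>' \<and>
       (\<forall>s\<in>{-h..0}. (\<phi> has_vector_derivative \<phi>' s) (at s within {-h..0}))}"

definition lipschitz_functional ::
  "real \<Rightarrow> 'b::real_normed_vector set \<Rightarrow> ((real \<Rightarrow> 'b) \<Rightarrow> real) \<Rightarrow> bool" where
  "lipschitz_functional h H r \<longleftrightarrow>
     (\<exists>L\<ge>0. \<forall>\<phi>\<in>C_space h H. \<forall>\<psi>\<in>C_space h H.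
        \<bar>r \<phi> - r \<psi>\<bar> \<le> L * sup_norm h (\<lambda>s. \<phi> s - \<psi> s))"

definition maps_bounded_sets_on :: "'b::real_normed_vector set \<Rightarrow> ('b \<Rightarrow> 'b) \<Rightarrow> bool" where
  "maps_bounded_sets_on H B \<longleftrightarrow> (\<forall>M\<subseteq>H. bounded M \<longrightarrow> bounded (B ` M))"

definition history :: "(real \<Rightarrow> 'b) \<Rightarrow> real \<Rightarrow> real \<Rightarrow> 'b" where
  "history u t = (\<lambda>s. u (t + s))"

definition delay_rhs :: "('b \<Rightarrow> 'b) \<Rightarrow> ((real \<Rightarrow> 'b) \<Rightarrow> real) \<Rightarrow> (real \<Rightarrow> 'b) \<Rightarrow> 'b" where
  "delay_rhs B r \<phi> = B (\<phi> (- r \<phi>))"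

definition classical_solution ::
  "real \<Rightarrow> 'b::real_normed_vector set \<Rightarrow> 'b set \<Rightarrow> ('b \<Rightarrow> 'b) \<Rightarrow> ((real \<Rightarrow> 'b) \<Rightarrow> 'b)
     \<Rightarrow> (real \<Rightarrow> 'b) \<Rightarrow> real \<Rightarrow> (real \<Rightarrow> 'b) \<Rightarrow> bool" where
  "classical_solution h H D A F \<phi> T u \<longleftrightarrow>
     u ` {-h..<T} \<subseteq> H \<and>
     continuous_on {-h..<T} u \<and>
     u C1_differentiable_on {0<..<T} \<and>
     (\<forall>s\<in>{-h..0}. u s = \<phi> s) \<and>
     (\<forall>t\<in>{0<..<T}. u t \<in> D) \<and>
     (\<forall>t\<in>{0<..<T}. vector_derivative u (at t) + A (u t) = F (history u t))"

end

theory Submission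
  imports Defs "HOL-Complex_Analysis.Cauchy_Integral_Formula"
begin

text \<open>
  The delayed term \<open>F(u\<^sub>t) = B(u(t - r(u\<^sub>t)))\<close> is in general not Lipschitz on the space of continuous histories, because a
  perturbation of the state moves the point at which the history is evaluated. It is Lipschitz along Lipschitz
  functions (\<open>norm_F_history_diff_le\<close>, \<open>norm_F_history_compare\<close>), and the proof therefore works with the
  variation of constants formula \<open>u(t) = T(t) \<phi>(0) + \<integral>\<^sub>0\<^sup>t T(s) F(u\<^sub>t\<^sub>-\<^sub>s) ds\<close> in the set of
  functions with a fixed Lipschitz constant \<open>M\<close>.

  This set is invariant on a short time interval: the orbit \<open>T(t) \<phi>(0)\<close> is Lipschitz since \<open>\<phi>(0)\<close> lies in the domain
  of the generator, and the Lipschitz constant of the integral is controlled by the size of the forcing,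
  while the Lipschitz constant of the forcing enters only with a factor of the length of the interval
  (\<open>norm_conv_diff_le\<close>). On a possibly shorter interval the map is a contraction in the supremum norm, and its
  fixed point is a Lipschitz mild solution (\<open>lipschitz_mild_solution_exists\<close>).

  The fixed point is a classical solution because its forcing term is Lipschitz in time. Analyticity gives
  \<open>norm (A (T t x)) \<le> K / t * norm x\<close> for small \<open>t\<close> (\<open>analytic_semigroup_smoothing\<close>, from Cauchy's inequality on discs of radius
  proportional to \<open>t\<close> and the uniform boundedness principle). In the formal expression
  \<open>\<integral> A (T(s) f(t - s)) ds\<close> the difference \<open>f(t - s) - f(t)\<close> cancels the singularity, and \<open>A\<close> applied to the
  constant part integrates exactly (\<open>conv_regular\<close>, \<open>continuous_on_G_conv\<close>).

  For uniqueness, every classical solution satisfies the variation of constants formula (\<open>classical_imp_mild\<close>), and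
  the comparison of the forcing terms of two functions requires only one of them to be Lipschitz. So any
  classical solution can be compared with the fixed point (\<open>classical_solution_eq\<close>).
\<close>

section \<open>Integrals and bounded operators on closed subspaces\<close>

lemma norm_has_integral_le:
  fixes g :: "real \<Rightarrow> 'c::real_normed_vector"
  assumes "(g has_integral I) {a..b}" "a \<le> b" "\<And>s. a \<le> s \<Longrightarrow> s \<le> b \<Longrightarrow> norm (g s) \<le> M"
  shows "norm I \<le> M * (b - a)"
proof -
  have "0 \<le> M" using assms(3)[of a] assms(2) by (auto intro: order_trans[OF norm_ge_zero])
  then show ?thesis
    using has_integral_bound[of M g I a b] assms by simp
qed

lemma has_vector_derivative_difference_quotient:
  fixes f :: "real \<Rightarrow> 'b::real_normed_vector"
  shows "(f has_vector_derivative d) (at t) \<longleftrightarrow> ((\<lambda>s. (f (t + s) - f t) /\<^sub>R s) \<longlongrightarrow> d) (at 0)"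
proof -
  have "((\<lambda>s. norm (f (t + s) - f t - s *\<^sub>R d) / norm s) \<longlongrightarrow> 0) (at 0) \<longleftrightarrow>
      ((\<lambda>s. norm ((f (t + s) - f t) /\<^sub>R s - d)) \<longlongrightarrow> 0) (at 0)"
  proof (rule tendsto_cong, unfold eventually_at_filter, intro always_eventually allI impI)
    fix s :: real assume s: "s \<noteq> 0"
    have "norm (f (t + s) - f t - s *\<^sub>R d) = norm (s *\<^sub>R ((f (t + s) - f t) /\<^sub>R s - d))"
      using s by (simp add: scaleR_diff_right)
    then show "norm (f (t + s) - f t - s *\<^sub>R d) / norm s = norm ((f (t + s) - f t) /\<^sub>R s - d)"
      using s by simp
  qed
  then show ?thesis
    by (simp add: has_vector_derivative_def has_derivative_at bounded_linear_scaleR_left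
        tendsto_norm_zero_iff LIM_zero_iff)
qed

lemma lipschitz_on_C1_interval:
  fixes \<phi> :: "real \<Rightarrow> 'b::real_normed_vector"
  assumes "continuous_on {a..b} \<phi>'"
    and "\<And>s. s \<in> {a..b} \<Longrightarrow> (\<phi> has_vector_derivative \<phi>' s) (at s within {a..b})"
  obtains M where "M-lipschitz_on {a..b} \<phi>"
proof -
  have "bounded (\<phi>' ` {a..b})"
    by (intro compact_imp_bounded compact_continuous_image assms(1)) auto
  then obtain M where M: "M > 0" "\<And>s. s \<in> {a..b} \<Longrightarrow> norm (\<phi>' s) \<le> M"
    unfolding bounded_pos by auto
  have "M-lipschitz_on {a..b} \<phi>"
  proof (rule lipschitz_onI)
    fix x y assume "x \<in> {a..b}" "y \<in> {a..b}"
    then have "norm (\<phi> x - \<phi> y) \<le> M * norm (x - y)"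
    proof (intro differentiable_bound)
      show "(\<phi> has_derivative (\<lambda>h. h *\<^sub>R \<phi>' s)) (at s within {a..b})" if "s \<in> {a..b}" for s
        using assms(2)[OF that] by (simp add: has_vector_derivative_def)
      show "onorm (\<lambda>h. h *\<^sub>R \<phi>' s) \<le> M" if "s \<in> {a..b}" for s
        using M(2)[OF that] M(1) by (intro onorm_le) (auto simp: mult.commute[of M] intro!: mult_left_mono)
    qed auto
    then show "dist (\<phi> x) (\<phi> y) \<le> M * dist x y"
      by (simp add: dist_norm)
  qed (use M in auto)
  then show ?thesis by (rule that)
qed

text \<open>
  Riemann sums stay in the subspace, and the integral is a limit of Riemann sums.
\<close>

lemma has_integral_in_closed_subspace:
  fixes f :: "real \<Rightarrow> 'b::real_normed_vector"
  assumes V: "subspace V" "closed V"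
    and f: "(f has_integral I) {a..b}" "\<And>x. x \<in> {a..b} \<Longrightarrow> f x \<in> V"
  shows "I \<in> V"
proof -
  have "\<exists>y\<in>V. dist y I < e" if "e > 0" for e
  proof -
    obtain \<gamma> where "gauge \<gamma>"
      and \<gamma>: "\<And>\<D>. \<D> tagged_division_of {a..b} \<Longrightarrow> \<gamma> fine \<D> \<Longrightarrow>
        norm (sum (\<lambda>(x,k). measure lborel k *\<^sub>R f x) \<D> - I) < e"
      using f(1) \<open>e > 0\<close> unfolding has_integral_real by metis
    obtain \<D> where \<D>: "\<D> tagged_division_of {a..b}" "\<gamma> fine \<D>"
      using fine_division_exists[OF \<open>gauge \<gamma>\<close>, of a b] by (metis box_real(2))
    have "(\<Sum>(x,k)\<in>\<D>. measure lborel k *\<^sub>R f x) \<in> V"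
    proof (intro subspace_sum[OF V(1)])
      fix p assume "p \<in> \<D>"
      then have "fst p \<in> {a..b}"
        using tagged_division_ofD(2,3)[OF \<D>(1), of "fst p" "snd p"] by auto
      then show "(case p of (x, k) \<Rightarrow> measure lborel k *\<^sub>R f x) \<in> V"
        using f(2) by (simp add: case_prod_unfold subspace_scale[OF V(1)])
    qed
    then show ?thesis
      using \<gamma>[OF \<D>] by (auto simp: dist_norm)
  qed
  then show ?thesis
    using closed_approachable[OF V(2)] by blast
qed

lemma continuous_on_if_linear_bounded:
  assumes "subspace H"
    and add: "\<And>x y. x \<in> H \<Longrightarrow> y \<in> H \<Longrightarrow> S (x + y) = S x + S y"
    and scale: "\<And>a x. x \<in> H \<Longrightarrow> S (a *\<^sub>R x) = a *\<^sub>R S x"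
    and K: "\<exists>K. \<forall>x\<in>H. norm (S x) \<le> K * norm x"
  shows "continuous_on H S"
proof -
  obtain K where K: "\<And>x. x \<in> H \<Longrightarrow> norm (S x) \<le> K * norm x"
    using K by blast
  have "\<bar>K\<bar>-lipschitz_on H S"
  proof (rule lipschitz_onI)
    fix x y assume xy: "x \<in> H" "y \<in> H"
    have "S (x + (-1) *\<^sub>R y) = S x + (-1) *\<^sub>R S y"
      using xy assms(1) by (metis add scale subspace_scale)
    moreover have "norm (S (x - y)) \<le> \<bar>K\<bar> * norm (x - y)"
      by (rule order_trans[OF K[OF subspace_diff[OF assms(1) xy]]]) (intro mult_right_mono, auto)
    ultimately show "dist (S x) (S y) \<le> \<bar>K\<bar> * dist x y"
      by (simp add: dist_norm)
  qed auto
  then show ?thesis by (rule lipschitz_on_continuous_on)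
qed

lemma bounded_linear_on_diff:
  assumes "subspace H" "bounded_linear_on H S" "x \<in> H" "y \<in> H"
  shows "S (x - y) = S x - S y"
proof -
  have "S (x + (-1) *\<^sub>R y) = S x + (-1) *\<^sub>R S y"
    using assms by (metis bounded_linear_on_def subspace_scale)
  then show ?thesis by simp
qed

lemma bounded_linear_on_continuous:
  assumes "subspace H" "bounded_linear_on H S"
  shows "continuous_on H S"
  using assms(2) unfolding bounded_linear_on_def
  by (intro continuous_on_if_linear_bounded[OF assms(1)]) blast+

text \<open>
  The operator is defined on \<open>H\<close> only, so it cannot simply be composed with the integral. Its graph,
  however, is a closed subspace of the product space, hence contains the integral of the curve
  \<open>x \<mapsto> (f x, S (f x))\<close>, whose components are the two integrals to be compared.
\<close>

lemma has_integral_bounded_linear_on: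
  fixes f :: "real \<Rightarrow> 'b::banach"
  assumes H: "subspace H" "closed H" and S: "bounded_linear_on H S"
    and f: "continuous_on {a..b} f" "\<And>x. x \<in> {a..b} \<Longrightarrow> f x \<in> H"
  shows "((\<lambda>x. S (f x)) has_integral S (integral {a..b} f)) {a..b}"
proof -
  let ?V = "{p. fst p \<in> H \<and> snd p = S (fst p)}"
  have S': "continuous_on H S"
    using H S by (intro bounded_linear_on_continuous)
  have cl: "closed ?V"
  proof -
    have "continuous_on (H \<times> UNIV) (\<lambda>p. snd p - S (fst p))"
      by (auto intro!: continuous_intros continuous_on_compose2[OF S'])
    then have "closed ((H \<times> UNIV) \<inter> (\<lambda>p. snd p - S (fst p)) -` {0})"
      using H(2) by (intro continuous_closed_preimage closed_Times closed_UNIV closed_singleton)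
    moreover have "?V = (H \<times> UNIV) \<inter> (\<lambda>p. snd p - S (fst p)) -` {0}"
      by auto
    ultimately show ?thesis by simp
  qed
  have sub: "subspace ?V"
    using H(1) S bounded_linear_on_diff[OF H(1) S, of 0 0]
    by (auto simp: subspace_def bounded_linear_on_def)
  have Sf: "continuous_on {a..b} (\<lambda>x. S (f x))"
    using f by (auto intro!: continuous_on_compose2[OF S'])
  then have "continuous_on {a..b} (\<lambda>x. (f x, S (f x)))"
    using f by (intro continuous_intros)
  then obtain I where I: "((\<lambda>x. (f x, S (f x))) has_integral I) {a..b}"
    using integrable_continuous_real by (metis integrable_on_def)
  have "I \<in> ?V"
    by (rule has_integral_in_closed_subspace[OF sub cl I]) (simp add: f(2))
  moreover have "(f has_integral fst I) {a..b}" "((\<lambda>x. S (f x)) has_integral snd I) {a..b}"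
    using has_integral_linear[OF I bounded_linear_fst] has_integral_linear[OF I bounded_linear_snd]
    unfolding o_def fst_conv snd_conv by blast+
  ultimately have "integral {a..b} f = fst I" "((\<lambda>x. S (f x)) has_integral S (fst I)) {a..b}"
    by (simp_all add: integral_unique)
  then show ?thesis by simp
qed

text \<open>
  The Banach-Steinhaus principle for operators given on a closed subspace. By the Baire category
  theorem one of the closed sets \<open>{x \<in> H. \<forall>n. norm (S n x) \<le> m}\<close> contains a relative ball, and linearity carries
  the bound from this ball to all of \<open>H\<close>.
\<close>

lemma uniform_boundedness_on:
  fixes S :: "nat \<Rightarrow> 'b::banach \<Rightarrow> 'c::real_normed_vector"
  assumes H: "subspace H" "closed H"
    and add: "\<And>n x y. x \<in> H \<Longrightarrow> y \<in> H \<Longrightarrow> S n (x + y) = S n x + S n y"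
    and scale: "\<And>n a x. x \<in> H \<Longrightarrow> S n (a *\<^sub>R x) = a *\<^sub>R S n x"
    and bd: "\<And>n. \<exists>K. \<forall>x\<in>H. norm (S n x) \<le> K * norm x"
    and pw: "\<And>x. x \<in> H \<Longrightarrow> bounded (range (\<lambda>n. S n x))"
  shows "\<exists>K. \<forall>n. \<forall>x\<in>H. norm (S n x) \<le> K * norm x"
proof -
  have cont: "continuous_on H (S n)" for n
    by (rule continuous_on_if_linear_bounded[OF H(1) add scale bd])
  define C where "C m = {x \<in> H. \<forall>n. norm (S n x) \<le> real m}" for m
  have C: "closedin (top_of_set H) (C m)" for m
  proof -
    have "closedin (top_of_set H) {x \<in> H. norm (S n x) \<le> real m}" for n
    proof -
      have "closedin (top_of_set H) (H \<inter> (\<lambda>x. norm (S n x)) -` {..real m})"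
        by (intro continuous_closedin_preimage continuous_intros cont closed_atMost)
      then show ?thesis by (simp add: vimage_def Int_def)
    qed
    moreover have "C m = (\<Inter>n. {x \<in> H. norm (S n x) \<le> real m})"
      by (auto simp: C_def)
    ultimately show ?thesis by (auto intro!: closedin_Inter)
  qed
  have "\<Union>(range C) = H"
  proof -
    have "x \<in> \<Union>(range C)" if "x \<in> H" for x
    proof -
      have "\<exists>B. \<forall>n. norm (S n x) \<le> B"
        using pw[OF that] by (simp add: bounded_iff)
      then obtain B where "\<forall>n. norm (S n x) \<le> B" ..
      then have "x \<in> C (nat \<lceil>B\<rceil>)"
        using that by (auto simp: C_def intro: order_trans real_nat_ceiling_ge)
      then show ?thesis by blast
    qed
    then show ?thesis by (auto simp: C_def)
  qed
  moreover have "(top_of_set H) interior_of H = H"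
    by (metis interior_of_topspace topspace_euclidean_subtopology)
  moreover have "0 \<in> H" by (rule subspace_0[OF H(1)])
  moreover have "completely_metrizable_space (top_of_set H)"
    using H(2) by (simp add: completely_metrizable_space_closedin completely_metrizable_space_euclidean)
  ultimately obtain m where "(top_of_set H) interior_of (C m) \<noteq> {}"
    using Baire_category_alt[of "top_of_set H" "range C"] C by fastforce
  then obtain U x\<^sub>0 where U: "openin (top_of_set H) U" "x\<^sub>0 \<in> U" "U \<subseteq> C m"
    by (auto simp: interior_of_def)
  then obtain \<rho> where \<rho>: "\<rho> > 0" "ball x\<^sub>0 \<rho> \<inter> H \<subseteq> C m"
    by (meson openin_contains_ball subset_trans)
  have x0: "x\<^sub>0 \<in> H" "norm (S n x\<^sub>0) \<le> real m" for n
    using U by (auto simp: C_def)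
  have "norm (S n y) \<le> (4 * real m / \<rho>) * norm y" if y: "y \<in> H" for n y
  proof (cases "y = 0")
    case True
    then show ?thesis using scale[OF y, of n 0] by simp
  next
    case False
    define c where "c = \<rho> / (2 * norm y)"
    have c: "c > 0" using False \<rho>(1) by (simp add: c_def)
    have "x\<^sub>0 + c *\<^sub>R y \<in> ball x\<^sub>0 \<rho> \<inter> H"
      using False \<rho>(1) y x0 H(1) c
      by (auto simp: dist_norm c_def intro!: subspace_add subspace_scale)
    then have "norm (S n (x\<^sub>0 + c *\<^sub>R y)) \<le> real m"
      using \<rho>(2) by (auto simp: C_def)
    moreover have "S n (x\<^sub>0 + c *\<^sub>R y) = S n x\<^sub>0 + c *\<^sub>R S n y"
      using x0 y H(1) by (simp add: add scale subspace_scale)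
    ultimately have "norm (c *\<^sub>R S n y) \<le> 2 * real m"
      using x0(2)[of n] norm_triangle_ineq4[of "S n x\<^sub>0 + c *\<^sub>R S n y" "S n x\<^sub>0"] by simp
    then have "c * norm (S n y) \<le> 2 * real m"
      using c by simp
    then have "norm (S n y) \<le> 2 * real m / c"
      using c by (simp add: field_simps)
    then show ?thesis by (simp add: c_def mult_ac)
  qed
  then show ?thesis by blast
qed

section \<open>Closedness of the state spaces and complex scalars\<close>

instance l2 :: (euclidean_space) banach ..

text \<open>
  The common reason why support and realness conditions survive limits in \<open>L\<^sup>2\<close>: the defect \<open>g\<close> of \<open>f\<close>
  (its restriction to the complement of \<open>\<Omega>\<close>, or its imaginary part) is pointwise at most the distance from
  \<open>f\<close> to any function without defect, so its norm is at most the \<open>L\<^sup>2\<close> distance to such functions.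
\<close>

lemma AE_eq_0_if_dominated_by_approximations:
  fixes f g :: "'a::euclidean_space \<Rightarrow> complex"
  assumes f: "square_integrable f" and g: "square_integrable g"
    and approx: "\<And>e. e > 0 \<Longrightarrow> \<exists>v. square_integrable v \<and> norm (abs_l2 f - abs_l2 v) < e \<and>
       (AE x in lebesgue. cmod (g x) \<le> cmod (f x - v x))"
  shows "AE x in lebesgue. g x = 0"
proof -
  have "norm (abs_l2 g) \<le> e" if e: "e > 0" for e
  proof -
    obtain v where v: "square_integrable v" "norm (abs_l2 f - abs_l2 v) < e"
      "AE x in lebesgue. cmod (g x) \<le> cmod (f x - v x)"
      using approx[OF e] by blast
    have fv: "square_integrable (\<lambda>x. f x - v x)" "abs_l2 f - abs_l2 v = abs_l2 (\<lambda>x. f x - v x)"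
      using diff_l2_abs[OF f v(1)] by auto
    have "(\<integral>x. (cmod (g x))\<^sup>2 \<partial>lebesgue) \<le> (\<integral>x. (cmod (f x - v x))\<^sup>2 \<partial>lebesgue)"
      using g fv(1) v(3)
      by (intro integral_mono_AE) (auto simp: square_integrable_def elim: eventually_mono intro: power_mono)
    then have "norm (abs_l2 g) \<le> norm (abs_l2 f - abs_l2 v)"
      using g fv by (simp add: norm_l2_abs)
    then show ?thesis using v(2) by simp
  qed
  then have "norm (abs_l2 g) \<le> 0"
    using field_le_epsilon[of "norm (abs_l2 g)" 0] by simp
  then have "abs_l2 g = abs_l2 (\<lambda>x. 0)"
    by (simp add: zero_l2_def)
  then have "l2_eq g (\<lambda>x. 0)"
    using Quotient3_rel[OF Quotient3_l2, of g "\<lambda>x. 0"] g by (simp add: l2_eq_def)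
  then show ?thesis by (simp add: l2_eq_def)
qed

lemma vanishes_off_abs: "square_integrable f \<Longrightarrow>
    vanishes_off \<Omega> (abs_l2 f) \<longleftrightarrow> (AE x in lebesgue. x \<notin> \<Omega> \<longrightarrow> f x = 0)"
  by (simp add: vanishes_off.abs_eq l2_eq_def)

lemma real_valued_abs: "square_integrable f \<Longrightarrow>
    real_valued (abs_l2 f) \<longleftrightarrow> (AE x in lebesgue. f x \<in> \<real>)"
  by (simp add: real_valued.abs_eq l2_eq_def)

lemma square_integrable_mult_bounded:
  assumes f: "square_integrable f" and c: "c \<in> borel_measurable lebesgue" "\<And>x. cmod (c x) \<le> 1"
  shows "square_integrable (\<lambda>x. c x * f x)"
proof -
  have [measurable]: "f \<in> borel_measurable lebesgue" "c \<in> borel_measurable lebesgue"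
    using assms by (auto simp: square_integrable_def)
  have "integrable lebesgue (\<lambda>x. (cmod (c x * f x))\<^sup>2)"
  proof (rule Bochner_Integration.integrable_bound)
    show "integrable lebesgue (\<lambda>x. (cmod (f x))\<^sup>2)"
      using f by (simp add: square_integrable_def)
    show "AE x in lebesgue. norm ((cmod (c x * f x))\<^sup>2) \<le> norm ((cmod (f x))\<^sup>2)"
      using c(2) by (intro AE_I2) (auto simp: norm_mult power_mult_distrib intro!: mult_left_le_one_le power_le_one)
  qed measurable
  then show ?thesis by (simp add: square_integrable_def)
qed

lemma square_integrable_Im:
  assumes "square_integrable f"
  shows "square_integrable (\<lambda>x. complex_of_real (Im (f x)))"
proof -
  have [measurable]: "f \<in> borel_measurable lebesgue"
    using assms by (auto simp: square_integrable_def)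
  have "integrable lebesgue (\<lambda>x. (cmod (complex_of_real (Im (f x))))\<^sup>2)"
  proof (rule Bochner_Integration.integrable_bound)
    show "integrable lebesgue (\<lambda>x. (cmod (f x))\<^sup>2)"
      using assms by (simp add: square_integrable_def)
    show "AE x in lebesgue. norm ((cmod (complex_of_real (Im (f x))))\<^sup>2) \<le> norm ((cmod (f x))\<^sup>2)"
      by (intro AE_I2) (simp add: cmod_power2)
  qed measurable
  then show ?thesis by (simp add: square_integrable_def)
qed

lemma closed_L2_complex:
  fixes \<Omega> :: "'a::euclidean_space set"
  assumes "\<Omega> \<in> sets lebesgue"
  shows "closed (L2_complex \<Omega>)"
proof -
  have "u \<in> L2_complex \<Omega>" if u: "u \<in> closure (L2_complex \<Omega>)" for u
  proof -
    obtain f where f: "square_integrable f" "u = abs_l2 f"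
      by (rule l2_cases)
    have "AE x in lebesgue. indicator (- \<Omega>) x * f x = 0"
    proof (rule AE_eq_0_if_dominated_by_approximations[OF f(1)])
      show "square_integrable (\<lambda>x. indicator (- \<Omega>) x * f x)"
        using assms f(1) by (intro square_integrable_mult_bounded) (auto split: split_indicator)
      fix e :: real assume "e > 0"
      then obtain w where w: "w \<in> L2_complex \<Omega>" "dist w u < e"
        using u unfolding closure_approachable by blast
      obtain v where v: "square_integrable v" "w = abs_l2 v"
        by (rule l2_cases)
      have "AE x in lebesgue. x \<notin> \<Omega> \<longrightarrow> v x = 0"
        using w v by (simp add: L2_complex_def vanishes_off_abs)
      then have "AE x in lebesgue. cmod (indicator (- \<Omega>) x * f x) \<le> cmod (f x - v x)"
        by eventually_elim (auto split: split_indicator)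
      then show "\<exists>v. square_integrable v \<and> norm (abs_l2 f - abs_l2 v) < e \<and>
         (AE x in lebesgue. cmod (indicator (- \<Omega>) x * f x) \<le> cmod (f x - v x))"
        using v w(2) f(2) by (auto simp: dist_norm norm_minus_commute)
    qed
    then have "AE x in lebesgue. x \<notin> \<Omega> \<longrightarrow> f x = 0"
      by eventually_elim (auto split: split_indicator_asm)
    then show ?thesis
      using f by (simp add: L2_complex_def vanishes_off_abs)
  qed
  then show ?thesis
    using closure_subset_eq by blast
qed

lemma closed_real_valued: "closed {u :: 'a::euclidean_space l2. real_valued u}"
proof -
  have "real_valued u" if u: "u \<in> closure {u. real_valued u}" for u :: "'a l2"
  proof -
    obtain f where f: "square_integrable f" "u = abs_l2 f"
      by (rule l2_cases)
    have "AE x in lebesgue. complex_of_real (Im (f x)) = 0"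
    proof (rule AE_eq_0_if_dominated_by_approximations[OF f(1)])
      show "square_integrable (\<lambda>x. complex_of_real (Im (f x)))"
        using f(1) by (rule square_integrable_Im)
      fix e :: real assume "e > 0"
      then obtain w where w: "real_valued w" "dist w u < e"
        using u unfolding closure_approachable by blast
      obtain v where v: "square_integrable v" "w = abs_l2 v"
        by (rule l2_cases)
      have "AE x in lebesgue. v x \<in> \<real>"
        using w v by (simp add: real_valued_abs)
      then have "AE x in lebesgue. cmod (complex_of_real (Im (f x))) \<le> cmod (f x - v x)"
      proof eventually_elim
        case (elim x)
        then have "Im (f x) = Im (f x - v x)"
          by (simp add: complex_is_Real_iff)
        then show ?case by (metis abs_Im_le_cmod norm_of_real)
      qed
      then show "\<exists>v. square_integrable v \<and> norm (abs_l2 f - abs_l2 v) < e \<and>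
         (AE x in lebesgue. cmod (complex_of_real (Im (f x))) \<le> cmod (f x - v x))"
        using v w(2) f(2) by (auto simp: dist_norm norm_minus_commute)
    qed
    then have "AE x in lebesgue. f x \<in> \<real>"
      by eventually_elim (simp add: complex_is_Real_iff)
    then show ?thesis
      using f by (simp add: real_valued_abs)
  qed
  then show ?thesis
    using closure_subset_eq by blast
qed

lemma subspace_L2_complex: "subspace (L2_complex \<Omega>)"
  unfolding subspace_def L2_complex_def mem_Collect_eq
proof (intro conjI ballI allI)
  show "vanishes_off \<Omega> 0"
    by transfer simp
  show "vanishes_off \<Omega> (x + y)" if "x \<in> Collect (vanishes_off \<Omega>)" "y \<in> Collect (vanishes_off \<Omega>)" for x y
    using that unfolding mem_Collect_eq by transfer (auto elim: eventually_elim2)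
  show "vanishes_off \<Omega> (c *\<^sub>R x)" if "x \<in> Collect (vanishes_off \<Omega>)" for c x
    using that unfolding mem_Collect_eq by transfer (auto elim: eventually_mono)
qed

lemma subspace_real_valued: "subspace {u. real_valued u}"
  unfolding subspace_def mem_Collect_eq
proof (intro conjI ballI allI)
  show "real_valued (0 :: 'a l2)"
    by transfer simp
  show "real_valued (x + y)" if "x \<in> Collect real_valued" "y \<in> Collect real_valued" for x y :: "'a l2"
    using that unfolding mem_Collect_eq by transfer (auto elim: eventually_elim2)
  show "real_valued (c *\<^sub>R x)" if "x \<in> Collect real_valued" for c and x :: "'a l2"
    using that unfolding mem_Collect_eq by transfer (auto elim: eventually_mono)
qed

lemma L2_real_eq: "L2_real \<Omega> = L2_complex \<Omega> \<inter> {u. real_valued u}"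
  by (auto simp: L2_real_def L2_complex_def)

lemma scaleC_add_right: "c *\<^sub>C (u + v) = c *\<^sub>C u + c *\<^sub>C v"
  by transfer (auto simp: l2_eq_def distrib_left intro!: square_integrable_add square_integrable_scale)

lemma scaleC_add_left: "(b + c) *\<^sub>C u = b *\<^sub>C u + c *\<^sub>C u"
  by transfer (auto simp: l2_eq_def distrib_right intro!: square_integrable_add square_integrable_scale)

lemma scaleC_scaleC: "b *\<^sub>C (c *\<^sub>C u) = (b * c) *\<^sub>C u"
  by transfer (auto simp: l2_eq_def mult.assoc intro!: square_integrable_scale)

lemma scaleC_of_real: "complex_of_real a *\<^sub>C u = a *\<^sub>R u"
  by transfer (auto simp: l2_eq_def intro!: square_integrable_scale)

lemma norm_ii_scaleC: "norm (\<i> *\<^sub>C u) = norm u"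
  by transfer (simp add: norm_mult)

lemma bounded_linear_ii_scaleC: "bounded_linear (\<lambda>u. \<i> *\<^sub>C u)"
proof (rule bounded_linear_intro[where K = 1])
  show "\<i> *\<^sub>C (a *\<^sub>R u) = a *\<^sub>R (\<i> *\<^sub>C u)" for a and u :: "'a l2"
    by (simp add: scaleC_of_real[symmetric] scaleC_scaleC mult.commute)
qed (simp_all add: scaleC_add_right norm_ii_scaleC)

lemma scaleC_Complex: "z *\<^sub>C u = Re z *\<^sub>R u + Im z *\<^sub>R (\<i> *\<^sub>C u)"
  by (subst complex_eq[of z])
    (simp only: scaleC_add_left scaleC_of_real[symmetric] scaleC_scaleC mult.commute)

text \<open>
  The complex inner product \<open>\<integral> v cnj(y)\<close>, written in terms of the real one. It turns
  a complex differentiable curve in \<open>L\<^sup>2\<close> into a scalar holomorphic function.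
\<close>

definition hermitian :: "'a::euclidean_space l2 \<Rightarrow> 'a l2 \<Rightarrow> complex" where
  "hermitian y v = Complex (v \<bullet> y) (- ((\<i> *\<^sub>C v) \<bullet> y))"

lemma hermitian_scaleC: "hermitian y (z *\<^sub>C v) = z * hermitian y v"
proof -
  have ii: "\<i> *\<^sub>C (\<i> *\<^sub>C v) = - v"
    using scaleC_of_real[of "-1" v] by (simp add: scaleC_scaleC)
  interpret ii: bounded_linear "\<lambda>u::'a l2. \<i> *\<^sub>C u" by (rule bounded_linear_ii_scaleC)
  show ?thesis
    by (rule complex_eqI)
      (simp_all add: hermitian_def scaleC_Complex[of z] ii.add ii.scaleR ii inner_add_left inner_diff_left)
qed

lemma bounded_linear_hermitian: "bounded_linear (hermitian y)"
proof -
  have "bounded_linear (\<lambda>v. complex_of_real (v \<bullet> y) - \<i> * complex_of_real ((\<i> *\<^sub>C v) \<bullet> y))"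
    by (intro bounded_linear_sub bounded_linear_const_mult
        bounded_linear_compose[OF bounded_linear_of_real]
        bounded_linear_inner_left bounded_linear_compose[OF bounded_linear_inner_left]
        bounded_linear_ii_scaleC)
  moreover have "hermitian y = (\<lambda>v. complex_of_real (v \<bullet> y) - \<i> * complex_of_real ((\<i> *\<^sub>C v) \<bullet> y))"
    by (simp add: fun_eq_iff hermitian_def complex_eq_iff)
  ultimately show ?thesis by simp
qed

lemma norm_hermitian_le: "norm (hermitian y v) \<le> 2 * (norm v * norm y)"
proof -
  have "norm (hermitian y v) \<le> \<bar>v \<bullet> y\<bar> + \<bar>(\<i> *\<^sub>C v) \<bullet> y\<bar>"
    using cmod_le[of "hermitian y v"] by (simp add: hermitian_def)
  also have "\<dots> \<le> norm v * norm y + norm (\<i> *\<^sub>C v) * norm y"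
    by (intro add_mono Cauchy_Schwarz_ineq2)
  finally show ?thesis by (simp add: norm_ii_scaleC)
qed

text \<open>
  Cauchy's inequality for a vector-valued function: it is applied to the scalar function obtained by pairing
  with the derivative \<open>d z\<close> itself, so that the derivative of the scalar function at \<open>z\<close> is the square of
  the norm to be estimated.
\<close>

lemma norm_complex_derivative_le:
  fixes F :: "complex \<Rightarrow> 'a::euclidean_space l2"
  assumes "0 < \<rho>"
    and der: "\<And>w. w \<in> cball z \<rho> \<Longrightarrow> (F has_derivative (\<lambda>h. h *\<^sub>C d w)) (at w)"
    and le: "\<And>w. w \<in> cball z \<rho> \<Longrightarrow> norm (F w) \<le> M"
  shows "norm (d z) \<le> 2 * M / \<rho>"
proof (cases "d z = 0")
  case True
  have "0 \<le> M" using le[of z] \<open>0 < \<rho>\<close> by (auto intro: order_trans[OF norm_ge_zero])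
  then show ?thesis using True \<open>0 < \<rho>\<close> by simp
next
  case False
  let ?g = "\<lambda>w. hermitian (d z) (F w)"
  have g: "(?g has_field_derivative hermitian (d z) (d w)) (at w)" if "w \<in> cball z \<rho>" for w
  proof -
    have "(?g has_derivative (\<lambda>h. hermitian (d z) (h *\<^sub>C d w))) (at w)"
      by (rule bounded_linear.has_derivative[OF bounded_linear_hermitian der[OF that]])
    then show ?thesis
      by (simp add: has_field_derivative_def hermitian_scaleC mult.commute[of _ "hermitian _ _"])
  qed
  have "norm ((deriv ^^ 1) ?g z) \<le> fact 1 * (2 * (M * norm (d z))) / \<rho> ^ 1"
  proof (rule Cauchy_inequality[OF _ _ \<open>0 < \<rho>\<close>])
    show "?g holomorphic_on ball z \<rho>"
      unfolding holomorphic_on_def field_differentiable_def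
      using g by (meson ball_subset_cball has_field_derivative_at_within subsetD)
    show "continuous_on (cball z \<rho>) ?g"
      using g by (meson DERIV_isCont continuous_at_imp_continuous_on)
    show "norm (?g x) \<le> 2 * (M * norm (d z))" if "norm (z - x) = \<rho>" for x
    proof -
      have "norm (F x) \<le> M" using that by (intro le) (simp add: dist_norm)
      then show ?thesis
        by (intro order_trans[OF norm_hermitian_le] mult_left_mono mult_right_mono) auto
    qed
  qed
  moreover have "deriv ?g z = hermitian (d z) (d z)"
    using g[of z] \<open>0 < \<rho>\<close> by (intro DERIV_imp_deriv) auto
  moreover have "(norm (d z))\<^sup>2 \<le> norm (hermitian (d z) (d z))"
    using complex_Re_le_cmod[of "hermitian (d z) (d z)"]
    by (simp add: hermitian_def power2_norm_eq_inner)
  ultimately have "(norm (d z))\<^sup>2 \<le> (2 * M / \<rho>) * norm (d z)"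
    by simp
  then show ?thesis
    unfolding power2_eq_square by (rule mult_right_le_imp_le) (simp add: False)
qed

section \<open>The smoothing estimate for analytic semigroups\<close>

text \<open>
  The sector is invariant under positive scaling, so a disc around \<open>1\<close> inside it gives, for every \<open>t > 0\<close>,
  a disc around \<open>t\<close> whose radius is proportional to \<open>t\<close>. This proportionality is the source of the
  factor \<open>1 / t\<close> in the smoothing estimate.
\<close>

lemma cball_subset_sector:
  assumes "0 < \<theta>" "\<theta> \<le> pi / 2"
  obtains \<rho> where "0 < \<rho>" "\<rho> < 1"
    "\<And>t. 0 < t \<Longrightarrow> cball (complex_of_real t) (\<rho> * t) \<subseteq> sector \<theta>"
proof -
  have "isCont Arg 1"
    by (rule continuous_at_Arg) (simp add: complex_nonpos_Reals_iff)
  then have "\<forall>\<^sub>F z in at 1. dist (Arg z) (Arg 1) < \<theta>"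
    using assms(1) by (auto simp: isCont_def dest: tendstoD)
  then obtain e where e: "e > 0" "\<And>z. z \<noteq> 1 \<Longrightarrow> dist z 1 < e \<Longrightarrow> \<bar>Arg z\<bar> < \<theta>"
    by (auto simp: eventually_at dist_real_def)
  define \<rho> where "\<rho> = min e 1 / 2"
  have \<rho>: "0 < \<rho>" "\<rho> < 1" "\<rho> < e" using e(1) by (auto simp: \<rho>_def)
  have "cball (complex_of_real t) (\<rho> * t) \<subseteq> sector \<theta>" if t: "0 < t" for t
  proof
    fix z assume z: "z \<in> cball (complex_of_real t) (\<rho> * t)"
    define w where "w = z / of_real t"
    have zw: "z = of_real t * w" using t by (simp add: w_def)
    have "norm (of_real t * (1 - w)) \<le> \<rho> * t"
      using z by (simp add: zw dist_norm algebra_simps)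
    then have w: "norm (1 - w) \<le> \<rho>"
      using t by (simp add: norm_mult)
    then have "w \<noteq> 0" using \<rho> by auto
    moreover have "\<bar>Arg w\<bar> < \<theta>"
      using e(2)[of w] w \<rho> assms(1) by (cases "w = 1") (auto simp: dist_norm norm_minus_commute)
    ultimately show "z \<in> sector \<theta>"
      using t by (simp add: sector_def zw)
  qed
  then show ?thesis using \<rho> that by blast
qed

text \<open>
  Otherwise some sequence of times tending to \<open>0\<close> in the sector carries operators with unbounded norms, although
  each orbit converges along it; this contradicts uniform boundedness.
\<close>

lemma analytic_semigroup_bounded_near_0:
  fixes H :: "'a::euclidean_space l2 set"
  assumes H: "subspace H" "closed H"
    and S: "\<And>z. z \<in> insert 0 (sector \<theta>) \<Longrightarrow> bounded_linear_on H' (S z)" and "H \<subseteq> H'"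
    and S0: "\<And>x. x \<in> H \<Longrightarrow> S 0 x = x"
    and lim: "\<And>x. x \<in> H \<Longrightarrow> ((\<lambda>z. S z x) \<longlongrightarrow> x) (at 0 within sector \<theta>)"
  shows "\<exists>\<delta>>0. \<exists>K. \<forall>z\<in>insert 0 (sector \<theta>). norm z < \<delta> \<longrightarrow> (\<forall>x\<in>H. norm (S z x) \<le> K * norm x)"
proof (rule ccontr)
  assume contr: "\<not> ?thesis"
  have "\<exists>z. z \<in> insert 0 (sector \<theta>) \<and> norm z < inverse (real (Suc n)) \<and>
      (\<exists>x\<in>H. norm (S z x) > real n * norm x)" for n
  proof -
    have "inverse (real (Suc n)) > 0" by simp
    then show ?thesis using contr by (meson not_le)
  qed
  then obtain z where z: "\<And>n. z n \<in> insert 0 (sector \<theta>)" "\<And>n. norm (z n) < inverse (real (Suc n))"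
    and large: "\<And>n. \<exists>x\<in>H. norm (S (z n) x) > real n * norm x"
    by metis
  have z0: "z \<longlonglongrightarrow> 0"
    by (rule Lim_null_comparison[OF always_eventually LIMSEQ_inverse_real_of_nat])
      (use z(2) in \<open>auto intro: less_imp_le\<close>)
  have "bounded (range (\<lambda>n. S (z n) x))" if x: "x \<in> H" for x
  proof -
    have "continuous (at 0 within insert 0 (sector \<theta>)) (\<lambda>z. S z x)"
    proof -
      have "at 0 within insert 0 (sector \<theta>) = at 0 within sector \<theta>"
        by (simp add: at_within_def sector_def)
      then show ?thesis
        using lim[OF x] S0[OF x] by (simp add: continuous_within)
    qed
    then have "((\<lambda>z. S z x) \<circ> z) \<longlonglongrightarrow> S 0 x"
      using z z0 unfolding continuous_within_sequentially by blast
    then show ?thesis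
      using convergent_imp_bounded by (fastforce simp: o_def)
  qed
  moreover have "S (z n) (x + y) = S (z n) x + S (z n) y" "S (z n) (a *\<^sub>R x) = a *\<^sub>R S (z n) x"
    if "x \<in> H" "y \<in> H" for n a x y
    using S[OF z(1)[of n]] that \<open>H \<subseteq> H'\<close> unfolding bounded_linear_on_def by blast+
  moreover have "\<exists>K. \<forall>x\<in>H. norm (S (z n) x) \<le> K * norm x" for n
    using S[OF z(1)[of n]] \<open>H \<subseteq> H'\<close> unfolding bounded_linear_on_def by blast
  ultimately obtain K where K: "\<And>n x. x \<in> H \<Longrightarrow> norm (S (z n) x) \<le> K * norm x"
    using uniform_boundedness_on[OF H, of "\<lambda>n. S (z n)"] by blast
  obtain n where n: "K \<le> real n"
    using real_arch_simple by blast
  obtain x where "x \<in> H" "norm (S (z n) x) > real n * norm x"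
    using large by blast
  then show False
    using K[of x n] mult_right_mono[OF n, of "norm x"] by simp
qed

text \<open>
  What analyticity contributes to the solution theory: for small \<open>t > 0\<close>, \<open>T t\<close> maps \<open>H\<close> into the domain of the generator, and
  \<open>norm (G (T t x))\<close> is at most of order \<open>1 / t\<close> as \<open>t\<close> tends to \<open>0\<close>. The vector \<open>G (T t x)\<close> is the complex derivative at \<open>t\<close> of the
  holomorphic orbit, which is bounded on discs of radius proportional to \<open>t\<close>.
\<close>

theorem analytic_semigroup_smoothing:
  fixes H :: "'a::euclidean_space l2 set"
  assumes H: "subspace H" "closed H"
    and T: "C0_semigroup_on H T" "analytic_semigroup_on H T"
    and gen: "is_generator H T D G"
  obtains \<delta> K where "0 < \<delta>" "0 < K"
    "\<And>t x. 0 \<le> t \<Longrightarrow> t \<le> \<delta> \<Longrightarrow> x \<in> H \<Longrightarrow> norm (T t x) \<le> K * norm x"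
    "\<And>t x. 0 < t \<Longrightarrow> t \<le> \<delta> \<Longrightarrow> x \<in> H \<Longrightarrow>
      T t x \<in> D \<and> ((\<lambda>s. T s x) has_vector_derivative G (T t x)) (at t) \<and> norm (G (T t x)) \<le> K / t * norm x"
proof -
  obtain \<theta> S where \<theta>: "0 < \<theta>" "\<theta> \<le> pi / 2"
    and ST': "\<forall>t\<ge>0. \<forall>x\<in>H. S (complex_of_real t) x = T t x"
    and S': "\<forall>z\<in>insert 0 (sector \<theta>). bounded_linear_on (complex_hull H) (S z) \<and>
           (\<forall>c. \<forall>x\<in>complex_hull H. S z (c *\<^sub>C x) = c *\<^sub>C S z x)"
    and S0: "\<forall>x\<in>complex_hull H. S 0 x = x"
    and der: "\<forall>x\<in>complex_hull H. \<forall>z\<in>sector \<theta>. \<exists>d.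
           ((\<lambda>w. S w x) has_derivative (\<lambda>h. h *\<^sub>C d)) (at z)"
    and lim: "\<forall>x\<in>complex_hull H. ((\<lambda>z. S z x) \<longlongrightarrow> x) (at 0 within sector \<theta>)"
    using T(2) unfolding analytic_semigroup_on_def by (elim exE conjE)
  have ST: "S (complex_of_real t) x = T t x" if "t \<ge> 0" "x \<in> H" for t x
    using ST' that by blast
  have S: "bounded_linear_on (complex_hull H) (S z)" if "z \<in> insert 0 (sector \<theta>)" for z
    using S' that by blast
  have hull: "H \<subseteq> complex_hull H"
  proof
    fix x assume "x \<in> H"
    moreover have "\<i> *\<^sub>C 0 = (0 :: 'a l2)"
      using norm_ii_scaleC[of "0 :: 'a l2"] by simp
    ultimately show "x \<in> complex_hull H"
      using subspace_0[OF H(1)] unfolding complex_hull_def by force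
  qed
  have "\<exists>\<delta>>0. \<exists>K. \<forall>z\<in>insert 0 (sector \<theta>). norm z < \<delta> \<longrightarrow> (\<forall>x\<in>H. norm (S z x) \<le> K * norm x)"
    by (rule analytic_semigroup_bounded_near_0[OF H S hull]) (use S0 lim hull in blast)+
  then obtain \<delta> K where \<delta>: "\<delta> > 0"
    and K': "\<forall>z\<in>insert 0 (sector \<theta>). norm z < \<delta> \<longrightarrow> (\<forall>x\<in>H. norm (S z x) \<le> K * norm x)"
    by (elim exE conjE)
  have K: "norm (S z x) \<le> K * norm x" if "z \<in> insert 0 (sector \<theta>)" "norm z < \<delta>" "x \<in> H" for z x
    using K' that by blast
  obtain \<rho> where \<rho>: "0 < \<rho>" "\<rho> < 1"
    and ball: "\<And>t. 0 < t \<Longrightarrow> cball (complex_of_real t) (\<rho> * t) \<subseteq> sector \<theta>"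
    using cball_subset_sector[OF \<theta>] by blast
  define M where "M = max K 1"
  have M: "norm (S z x) \<le> M * norm x" if "z \<in> insert 0 (sector \<theta>)" "norm z < \<delta>" "x \<in> H" for z x
    by (rule order_trans[OF K[OF that]]) (simp add: M_def mult_right_mono)
  have sec: "complex_of_real t \<in> sector \<theta>" if "0 < t" for t
    using ball[OF that] \<rho>(1) that by (auto simp: subset_iff)
  \<comment> \<open>For \<open>t \<le> \<delta> / 3\<close> the disc of radius \<open>\<rho> * t < t\<close> around \<open>t\<close> stays within distance \<open>\<delta>\<close> of \<open>0\<close>.\<close>
  have bound: "norm (T t x) \<le> M * norm x" if "0 \<le> t" "t \<le> \<delta> / 3" "x \<in> H" for t x
    using M[of "complex_of_real t" x] sec[of t] that \<delta> ST[of t x] by (cases "t = 0") auto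
  have smooth: "T t x \<in> D \<and> ((\<lambda>s. T s x) has_vector_derivative G (T t x)) (at t) \<and>
      norm (G (T t x)) \<le> (2 * M / \<rho>) / t * norm x" if t: "0 < t" "t \<le> \<delta> / 3" and x: "x \<in> H" for t x
  proof -
    have "\<forall>z\<in>sector \<theta>. \<exists>d. ((\<lambda>w. S w x) has_derivative (\<lambda>h. h *\<^sub>C d)) (at z)"
      using der hull x by blast
    then obtain d where d: "\<forall>z\<in>sector \<theta>. ((\<lambda>w. S w x) has_derivative (\<lambda>h. h *\<^sub>C d z)) (at z)"
      by (rule bchoice[THEN exE])
    let ?d = "d (complex_of_real t)"
    have "((\<lambda>s. S (complex_of_real s) x) has_derivative (\<lambda>h. complex_of_real h *\<^sub>C ?d)) (at t)"
      by (rule has_derivative_compose[where f = complex_of_real and g = "\<lambda>w. S w x"])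
        (use d sec[OF t(1)] in \<open>auto intro!: bounded_linear_imp_has_derivative bounded_linear_of_real\<close>)
    then have "((\<lambda>s. S (complex_of_real s) x) has_vector_derivative ?d) (at t)"
      by (simp add: has_vector_derivative_def scaleC_of_real)
    then have vd: "((\<lambda>s. T s x) has_vector_derivative ?d) (at t)"
      by (rule has_vector_derivative_transform_within_open[of _ _ _ "{0<..}"])
        (use t x ST in auto)
    have "((\<lambda>s. (T (t + s) x - T t x) /\<^sub>R s) \<longlongrightarrow> ?d) (at 0)"
      using vd by (simp add: has_vector_derivative_difference_quotient)
    then have "((\<lambda>s. (T (t + s) x - T t x) /\<^sub>R s) \<longlongrightarrow> ?d) (at_right 0)"
      by (rule tendsto_mono[rotated]) (simp add: at_le)
    moreover have "\<forall>\<^sub>F s in at_right 0. (T (t + s) x - T t x) /\<^sub>R s = (T s (T t x) - T t x) /\<^sub>R s"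
    proof -
      have "T (t + s) x = T s (T t x)" if "s > 0" for s
        using T(1) that t(1) x unfolding C0_semigroup_on_def by (metis add.commute less_imp_le)
      then show ?thesis by (auto simp: eventually_at_filter)
    qed
    ultimately have lim: "((\<lambda>s. (T s (T t x) - T t x) /\<^sub>R s) \<longlongrightarrow> ?d) (at_right 0)"
      by (rule Lim_transform_eventually)
    have "T t x \<in> H"
      using T(1) t x unfolding C0_semigroup_on_def bounded_linear_on_def by (meson image_subset_iff less_imp_le)
    then have D: "T t x \<in> D"
      using lim gen by (auto simp: is_generator_def generator_domain_def)
    then have "((\<lambda>s. (T s (T t x) - T t x) /\<^sub>R s) \<longlongrightarrow> G (T t x)) (at_right 0)"
      using gen by (simp add: is_generator_def)
    then have G: "G (T t x) = ?d"
      using tendsto_unique[OF trivial_limit_at_right_real _ lim] by blast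
    have "norm ?d \<le> 2 * (M * norm x) / (\<rho> * t)"
    proof (rule norm_complex_derivative_le)
      show "0 < \<rho> * t" using \<rho> t by simp
      fix w assume w: "w \<in> cball (complex_of_real t) (\<rho> * t)"
      then have sw: "w \<in> sector \<theta>" using ball[OF t(1)] by blast
      show "((\<lambda>w. S w x) has_derivative (\<lambda>h. h *\<^sub>C d w)) (at w)"
        using sw d by blast
      have "norm w \<le> norm (complex_of_real t) + norm (complex_of_real t - w)"
        using norm_triangle_ineq4[of "complex_of_real t" "complex_of_real t - w"] by simp
      also have "\<dots> \<le> t + \<rho> * t"
        using w t by (simp add: dist_norm)
      also have "\<dots> \<le> t + 1 * t"
        using t \<rho> by (intro add_left_mono mult_right_mono) auto
      finally show "norm (S w x) \<le> M * norm x"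
        using sw x t \<delta> by (intro M) auto
    qed
    then show ?thesis
      using D vd G \<rho> t by (simp add: field_simps)
  qed
  define C where "C = max M (2 * M / \<rho>)"
  have "1 \<le> M" by (simp add: M_def)
  show ?thesis
  proof (rule that[of "\<delta> / 3" C])
    show "\<delta> / 3 > 0" "C > 0"
      using \<delta> \<open>1 \<le> M\<close> by (auto simp: C_def)
    show "norm (T t x) \<le> C * norm x" if "0 \<le> t" "t \<le> \<delta> / 3" "x \<in> H" for t x
      by (rule order_trans[OF bound[OF that]]) (simp add: C_def mult_right_mono)
    show "T t x \<in> D \<and> ((\<lambda>s. T s x) has_vector_derivative G (T t x)) (at t) \<and> norm (G (T t x)) \<le> C / t * norm x"
      if "0 < t" "t \<le> \<delta> / 3" "x \<in> H" for t x
    proof -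
      have "(2 * M / \<rho>) / t * norm x \<le> C / t * norm x"
        using that by (intro mult_right_mono divide_right_mono) (auto simp: C_def)
      then show ?thesis using smooth[OF that] by linarith
    qed
  qed
qed

section \<open>The generator of a smoothing semigroup\<close>

text \<open>
  A semigroup on a real Banach space together with the conclusion of \<open>analytic_semigroup_smoothing\<close>. The estimates
  are local in time, for times up to \<open>\<delta>\<close>, like the solutions that they serve to construct.
\<close>

locale smoothing_semigroup =
  fixes H :: "'b::banach set" and T :: "real \<Rightarrow> 'b \<Rightarrow> 'b" and D :: "'b set" and G :: "'b \<Rightarrow> 'b"
    and \<delta> K :: real
  assumes subspace_H: "subspace H" and closed_H: "closed H"
    and semigroup: "C0_semigroup_on H T" and generator: "is_generator H T D G"
    and \<delta>_pos: "0 < \<delta>" and K_pos: "0 < K"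
    and norm_T_le: "0 \<le> t \<Longrightarrow> t \<le> \<delta> \<Longrightarrow> x \<in> H \<Longrightarrow> norm (T t x) \<le> K * norm x"
    and smoothing: "0 < t \<Longrightarrow> t \<le> \<delta> \<Longrightarrow> x \<in> H \<Longrightarrow>
      T t x \<in> D \<and> ((\<lambda>s. T s x) has_vector_derivative G (T t x)) (at t) \<and> norm (G (T t x)) \<le> K / t * norm x"
begin

lemma T_bounded_linear: "0 \<le> t \<Longrightarrow> bounded_linear_on H (T t)"
  using semigroup by (simp add: C0_semigroup_on_def)

lemma T_in: "0 \<le> t \<Longrightarrow> x \<in> H \<Longrightarrow> T t x \<in> H"
  using T_bounded_linear[of t] by (auto simp: bounded_linear_on_def)

lemma T_add: "0 \<le> t \<Longrightarrow> x \<in> H \<Longrightarrow> y \<in> H \<Longrightarrow> T t (x + y) = T t x + T t y"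
  using T_bounded_linear[of t] by (auto simp: bounded_linear_on_def)

lemma T_scaleR: "0 \<le> t \<Longrightarrow> x \<in> H \<Longrightarrow> T t (a *\<^sub>R x) = a *\<^sub>R T t x"
  using T_bounded_linear[of t] by (auto simp: bounded_linear_on_def)

lemma T_diff: "0 \<le> t \<Longrightarrow> x \<in> H \<Longrightarrow> y \<in> H \<Longrightarrow> T t (x - y) = T t x - T t y"
  using bounded_linear_on_diff[OF subspace_H T_bounded_linear] by blast

lemma T_0: "x \<in> H \<Longrightarrow> T 0 x = x"
  using semigroup by (simp add: C0_semigroup_on_def)

lemma T_plus: "0 \<le> s \<Longrightarrow> 0 \<le> t \<Longrightarrow> x \<in> H \<Longrightarrow> T (s + t) x = T s (T t x)"
  using semigroup by (simp add: C0_semigroup_on_def)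

lemma D_subset: "x \<in> D \<Longrightarrow> x \<in> H"
  using generator by (simp add: is_generator_def generator_domain_def)

lemma G_tendsto: "x \<in> D \<Longrightarrow> ((\<lambda>t. (T t x - x) /\<^sub>R t) \<longlongrightarrow> G x) (at_right 0)"
  using generator by (simp add: is_generator_def)

lemma G_eqI:
  assumes "x \<in> H" and lim: "((\<lambda>t. (T t x - x) /\<^sub>R t) \<longlongrightarrow> y) (at_right 0)"
  shows "x \<in> D" "G x = y"
proof -
  show "x \<in> D"
    using assms generator by (auto simp: is_generator_def generator_domain_def)
  then show "G x = y"
    using tendsto_unique[OF trivial_limit_at_right_real G_tendsto lim] by blast
qed

lemma G_in: assumes "x \<in> D" shows "G x \<in> H"
proof (rule Lim_in_closed_set[OF closed_H _ trivial_limit_at_right_real G_tendsto[OF assms]])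
  show "\<forall>\<^sub>F t in at_right 0. (T t x - x) /\<^sub>R t \<in> H"
    unfolding eventually_at_filter using D_subset[OF assms]
    by (auto intro!: always_eventually subspace_scale[OF subspace_H] subspace_diff[OF subspace_H] T_in)
qed

lemma G_add:
  assumes "x \<in> D" "y \<in> D" shows "x + y \<in> D" "G (x + y) = G x + G y"
proof -
  have H: "x + y \<in> H" using assms by (intro subspace_add[OF subspace_H] D_subset)
  have "((\<lambda>t. (T t x - x) /\<^sub>R t + (T t y - y) /\<^sub>R t) \<longlongrightarrow> G x + G y) (at_right 0)"
    by (intro tendsto_add G_tendsto assms)
  moreover have "\<forall>\<^sub>F t in at_right 0. (T t x - x) /\<^sub>R t + (T t y - y) /\<^sub>R t = (T t (x + y) - (x + y)) /\<^sub>R t"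
    unfolding eventually_at_filter using assms[THEN D_subset]
    by (auto intro!: always_eventually simp: T_add algebra_simps)
  ultimately have "((\<lambda>t. (T t (x + y) - (x + y)) /\<^sub>R t) \<longlongrightarrow> G x + G y) (at_right 0)"
    by (rule Lim_transform_eventually)
  then show "x + y \<in> D" "G (x + y) = G x + G y"
    using G_eqI[OF H] by auto
qed

lemma G_scaleR:
  assumes "x \<in> D" shows "a *\<^sub>R x \<in> D" "G (a *\<^sub>R x) = a *\<^sub>R G x"
proof -
  have H: "a *\<^sub>R x \<in> H" using assms by (intro subspace_scale[OF subspace_H] D_subset)
  have "((\<lambda>t. a *\<^sub>R ((T t x - x) /\<^sub>R t)) \<longlongrightarrow> a *\<^sub>R G x) (at_right 0)"
    by (intro tendsto_scaleR tendsto_const G_tendsto assms)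
  moreover have "\<forall>\<^sub>F t in at_right 0. a *\<^sub>R ((T t x - x) /\<^sub>R t) = (T t (a *\<^sub>R x) - a *\<^sub>R x) /\<^sub>R t"
    unfolding eventually_at_filter using assms[THEN D_subset]
    by (auto intro!: always_eventually simp: T_scaleR algebra_simps)
  ultimately have "((\<lambda>t. (T t (a *\<^sub>R x) - a *\<^sub>R x) /\<^sub>R t) \<longlongrightarrow> a *\<^sub>R G x) (at_right 0)"
    by (rule Lim_transform_eventually)
  then show "a *\<^sub>R x \<in> D" "G (a *\<^sub>R x) = a *\<^sub>R G x"
    using G_eqI[OF H] by auto
qed

lemma T_in_D: "0 < t \<Longrightarrow> t \<le> \<delta> \<Longrightarrow> x \<in> H \<Longrightarrow> T t x \<in> D"
  using smoothing by blast

lemma T_has_vector_derivative: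
  "0 < t \<Longrightarrow> t \<le> \<delta> \<Longrightarrow> x \<in> H \<Longrightarrow> ((\<lambda>s. T s x) has_vector_derivative G (T t x)) (at t)"
  using smoothing by blast

lemma norm_G_T_le: "0 < t \<Longrightarrow> t \<le> \<delta> \<Longrightarrow> x \<in> H \<Longrightarrow> norm (G (T t x)) \<le> K / t * norm x"
  using smoothing by blast

lemma G_T_bounded_linear:
  assumes "0 < t" "t \<le> \<delta>"
  shows "bounded_linear_on H (\<lambda>x. G (T t x))"
  unfolding bounded_linear_on_def
proof (intro conjI ballI allI)
  show "(\<lambda>x. G (T t x)) ` H \<subseteq> H"
    using assms T_in_D G_in by auto
  show "G (T t (x + y)) = G (T t x) + G (T t y)" if "x \<in> H" "y \<in> H" for x y
    using assms that by (simp add: T_add G_add T_in_D)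
  show "G (T t (a *\<^sub>R x)) = a *\<^sub>R G (T t x)" if "x \<in> H" for a x
    using assms that by (simp add: T_scaleR G_scaleR T_in_D)
  show "\<exists>K. \<forall>x\<in>H. norm (G (T t x)) \<le> K * norm x"
    using norm_G_T_le[OF assms] by blast
qed

lemma continuous_on_T:
  assumes "x \<in> H"
  shows "continuous_on {0..\<delta>} (\<lambda>t. T t x)"
  unfolding continuous_on_def
proof
  fix t assume t: "t \<in> {0..\<delta>}"
  show "((\<lambda>t. T t x) \<longlongrightarrow> T t x) (at t within {0..\<delta>})"
  proof (cases "t = 0")
    case True
    have "((\<lambda>t. T t x) \<longlongrightarrow> x) (at_right 0)"
      using semigroup assms by (simp add: C0_semigroup_on_def)
    then show ?thesis
      using True \<delta>_pos assms by (simp add: T_0 at_within_Icc_at_right)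
  next
    case False
    then have "isCont (\<lambda>t. T t x) t"
      using t assms by (intro has_vector_derivative_continuous[OF T_has_vector_derivative]) auto
    then show ?thesis
      by (auto simp: isCont_def intro: tendsto_within_subset)
  qed
qed

text \<open>
  The bound \<open>norm_T_le\<close> is uniform in time, so strong continuity upgrades to joint continuity in time and vector.
\<close>

lemma tendsto_T:
  assumes a: "(a \<longlongrightarrow> a\<^sub>0) F" "\<forall>\<^sub>F s in F. a s \<in> {0..\<delta>}" "a\<^sub>0 \<in> {0..\<delta>}"
    and f: "(f \<longlongrightarrow> f\<^sub>0) F" "\<forall>\<^sub>F s in F. f s \<in> H" "f\<^sub>0 \<in> H"
  shows "((\<lambda>s. T (a s) (f s)) \<longlongrightarrow> T a\<^sub>0 f\<^sub>0) F"
proof -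
  have "((\<lambda>s. K * norm (f s - f\<^sub>0)) \<longlongrightarrow> K * norm (f\<^sub>0 - f\<^sub>0)) F"
    by (intro tendsto_intros f)
  then have "((\<lambda>s. K * norm (f s - f\<^sub>0)) \<longlongrightarrow> 0) F" by simp
  then have "((\<lambda>s. T (a s) (f s - f\<^sub>0)) \<longlongrightarrow> 0) F"
  proof (rule Lim_null_comparison[rotated])
    show "\<forall>\<^sub>F s in F. norm (T (a s) (f s - f\<^sub>0)) \<le> K * norm (f s - f\<^sub>0)"
      using a(2) f(2) by eventually_elim (auto intro!: norm_T_le subspace_diff[OF subspace_H] f(3))
  qed
  moreover have "((\<lambda>s. T (a s) f\<^sub>0) \<longlongrightarrow> T a\<^sub>0 f\<^sub>0) F"
    by (rule continuous_on_tendsto_compose[OF continuous_on_T[OF f(3)] a(1) a(3) a(2)])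
  ultimately have "((\<lambda>s. T (a s) (f s - f\<^sub>0) + T (a s) f\<^sub>0) \<longlongrightarrow> 0 + T a\<^sub>0 f\<^sub>0) F"
    by (rule tendsto_add)
  moreover have "\<forall>\<^sub>F s in F. T (a s) (f s - f\<^sub>0) + T (a s) f\<^sub>0 = T (a s) (f s)"
    using a(2) f(2) by eventually_elim (use f(3) in \<open>auto simp: T_diff\<close>)
  ultimately show ?thesis
    using Lim_transform_eventually by fastforce
qed

lemma continuous_on_T_compose:
  assumes "continuous_on S a" "a ` S \<subseteq> {0..\<delta>}" "continuous_on S f" "f ` S \<subseteq> H"
  shows "continuous_on S (\<lambda>s. T (a s) (f s))"
  using assms unfolding continuous_on_def
  by (intro ballI tendsto_T) (auto simp: eventually_at_filter intro!: always_eventually)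

lemma G_T_commute:
  assumes x: "x \<in> D" and t: "0 \<le> t" "t \<le> \<delta>"
  shows "G (T t x) = T t (G x)"
proof (rule G_eqI(2))
  show "T t x \<in> H" using x t by (intro T_in D_subset)
  have ev: "\<forall>\<^sub>F s in at_right 0. (T s x - x) /\<^sub>R s \<in> H"
    unfolding eventually_at_filter using D_subset[OF x]
    by (auto intro!: always_eventually subspace_scale[OF subspace_H] subspace_diff[OF subspace_H] T_in)
  have "((\<lambda>s. T t ((T s x - x) /\<^sub>R s)) \<longlongrightarrow> T t (G x)) (at_right 0)"
    using t by (intro tendsto_T tendsto_const G_tendsto x G_in ev) auto
  moreover have "\<forall>\<^sub>F s in at_right 0. T t ((T s x - x) /\<^sub>R s) = (T s (T t x) - T t x) /\<^sub>R s"
    unfolding eventually_at_filter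
  proof (intro always_eventually allI impI)
    fix s :: real assume "s \<in> {0<..}"
    then have "0 \<le> s" by simp
    then have "T t (T s x) = T s (T t x)"
      using T_plus[of t s x] T_plus[of s t x] t D_subset[OF x] by (simp add: add.commute)
    then show "T t ((T s x - x) /\<^sub>R s) = (T s (T t x) - T t x) /\<^sub>R s"
      using t D_subset[OF x] \<open>0 \<le> s\<close>
      by (simp add: T_scaleR T_diff T_in subspace_diff[OF subspace_H])
  qed
  ultimately show "((\<lambda>s. (T s (T t x) - T t x) /\<^sub>R s) \<longlongrightarrow> T t (G x)) (at_right 0)"
    by (rule Lim_transform_eventually)
qed

lemma T_diff_has_integral:
  assumes x: "x \<in> H" and "0 < a" "a \<le> b" "b \<le> \<delta>"
  shows "((\<lambda>s. G (T s x)) has_integral T b x - T a x) {a..b}"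
  using assms
  by (intro fundamental_theorem_of_calculus_interior T_has_vector_derivative
      continuous_on_subset[OF continuous_on_T]) auto

lemma T_diff_has_integral_D:
  assumes x: "x \<in> D" and "0 \<le> a" "a \<le> b" "b \<le> \<delta>"
  shows "((\<lambda>s. T s (G x)) has_integral T b x - T a x) {a..b}"
proof (rule fundamental_theorem_of_calculus_interior)
  show "continuous_on {a..b} (\<lambda>s. T s x)"
    using assms by (intro continuous_on_subset[OF continuous_on_T] D_subset) auto
  show "((\<lambda>s. T s x) has_vector_derivative T s (G x)) (at s)" if "s \<in> {a<..<b}" for s
    using T_has_vector_derivative[of s x] that assms D_subset[OF x] by (simp add: G_T_commute)
qed (use assms in auto)

lemma norm_T_diff_D_le:
  assumes x: "x \<in> D" and "0 \<le> a" "a \<le> b" "b \<le> \<delta>"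
  shows "norm (T b x - T a x) \<le> K * norm (G x) * (b - a)"
  by (rule norm_has_integral_le[OF T_diff_has_integral_D[OF assms]])
    (use assms in \<open>auto intro!: norm_T_le G_in\<close>)

text \<open>
  Passing to the limit in \<open>T t x - x = \<integral> T s (G x)\<close> over \<open>{0..t}\<close>, with \<open>x\<close> replaced by \<open>xs n\<close>, leaves the same formula with
  \<open>y\<close> instead of \<open>G x\<close>; dividing by \<open>t\<close> then recovers \<open>y\<close> as the value of the generator.
\<close>

lemma G_closed:
  assumes xs: "\<And>n. xs n \<in> D" "xs \<longlonglongrightarrow> x" "(\<lambda>n. G (xs n)) \<longlonglongrightarrow> y"
  shows "x \<in> D" "G x = y"
proof -
  have x: "x \<in> H" and y: "y \<in> H"
    using closed_sequentially[OF closed_H, of xs x]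
      closed_sequentially[OF closed_H, of "\<lambda>n. G (xs n)" y] xs D_subset G_in by auto
  have int: "((\<lambda>s. T s y) has_integral T t x - x) {0..t}" if t: "0 < t" "t \<le> \<delta>" for t
  proof -
    have cont: "continuous_on {0..t} (\<lambda>s. T s y)"
      using t by (intro continuous_on_subset[OF continuous_on_T[OF y]]) auto
    let ?I = "integral {0..t} (\<lambda>s. T s y)"
    have I: "((\<lambda>s. T s y) has_integral ?I) {0..t}"
      by (intro integrable_integral integrable_continuous_real cont)
    have "norm (T t (xs n) - xs n - ?I) \<le> K * norm (G (xs n) - y) * t" for n
    proof -
      have "((\<lambda>s. T s (G (xs n)) - T s y) has_integral T t (xs n) - T 0 (xs n) - ?I) {0..t}"
        using t by (intro has_integral_diff I T_diff_has_integral_D xs) auto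
      then have "norm (T t (xs n) - T 0 (xs n) - ?I) \<le> K * norm (G (xs n) - y) * (t - 0)"
      proof (rule norm_has_integral_le)
        fix s assume "0 \<le> s" "s \<le> t"
        then have "T s (G (xs n)) - T s y = T s (G (xs n) - y)"
          using y xs(1) by (simp add: T_diff G_in)
        then show "norm (T s (G (xs n)) - T s y) \<le> K * norm (G (xs n) - y)"
          using \<open>0 \<le> s\<close> \<open>s \<le> t\<close> t y xs(1) by (auto intro!: norm_T_le subspace_diff[OF subspace_H] G_in)
      qed (use t in auto)
      then show ?thesis using xs(1) by (simp add: T_0 D_subset)
    qed
    moreover have "(\<lambda>n. K * norm (G (xs n) - y) * t) \<longlonglongrightarrow> 0"
    proof -
      have "(\<lambda>n. K * norm (G (xs n) - y) * t) \<longlonglongrightarrow> K * norm (y - y) * t"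
        by (intro tendsto_intros xs)
      then show ?thesis by simp
    qed
    ultimately have "(\<lambda>n. T t (xs n) - xs n - ?I) \<longlonglongrightarrow> 0"
      by (rule Lim_null_comparison[OF always_eventually[OF allI]])
    moreover have "(\<lambda>n. T t (xs n) - xs n - ?I) \<longlonglongrightarrow> T t x - x - ?I"
    proof (intro tendsto_diff tendsto_const xs(2))
      show "(\<lambda>n. T t (xs n)) \<longlonglongrightarrow> T t x"
        by (rule tendsto_T[OF tendsto_const _ _ xs(2)]) (use t x xs(1) D_subset in simp_all)
    qed
    ultimately have "T t x - x - ?I = 0"
      by (rule LIMSEQ_unique[symmetric])
    then show ?thesis using I by simp
  qed
  have "((\<lambda>t. (T t x - x) /\<^sub>R t) \<longlongrightarrow> y) (at_right 0)"
  proof (rule tendstoI)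
    fix e :: real assume e: "e > 0"
    have "((\<lambda>t. T t y) \<longlongrightarrow> y) (at_right 0)"
      using semigroup y by (simp add: C0_semigroup_on_def)
    then have "\<forall>\<^sub>F t in at_right 0. dist (T t y) y < e / 2"
      using e by (intro tendstoD) auto
    then obtain d where d: "d > 0" "\<And>t. 0 < t \<Longrightarrow> t < d \<Longrightarrow> dist (T t y) y < e / 2"
      unfolding eventually_at_right_field by auto
    have "dist ((T t x - x) /\<^sub>R t) y < e" if t: "0 < t" "t < min d \<delta>" for t
    proof -
      have "((\<lambda>s. T s y - y) has_integral T t x - x - (t - 0) *\<^sub>R y) {0..t}"
        using t has_integral_const_real[of y 0 t] by (intro has_integral_diff int) auto
      then have "norm (T t x - x - (t - 0) *\<^sub>R y) \<le> e / 2 * (t - 0)"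
      proof (rule norm_has_integral_le)
        fix s assume "0 \<le> s" "s \<le> t"
        then show "norm (T s y - y) \<le> e / 2"
          using d(2)[of s] t e y by (cases "s = 0") (auto simp: dist_norm T_0)
      qed (use t in auto)
      moreover have "T t x - x - (t - 0) *\<^sub>R y = t *\<^sub>R ((T t x - x) /\<^sub>R t - y)"
        using t by (simp add: algebra_simps)
      ultimately have "t * norm ((T t x - x) /\<^sub>R t - y) \<le> t * (e / 2)"
        using t by simp
      then show ?thesis
        using t e by (simp add: dist_norm)
    qed
    then show "\<forall>\<^sub>F t in at_right 0. dist ((T t x - x) /\<^sub>R t) y < e"
      unfolding eventually_at_right_field using d(1) \<delta>_pos by (intro exI[of _ "min d \<delta>"]) auto
  qed
  then show "x \<in> D" "G x = y"
    using G_eqI[OF x] by auto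
qed

section \<open>Convolution with the semigroup\<close>

text \<open>
  The Duhamel integral, with the time reflection on the forcing term: increments in \<open>t\<close> then fall on \<open>f\<close>
  and not on the semigroup, which is only strongly continuous.
\<close>

definition conv :: "(real \<Rightarrow> 'b) \<Rightarrow> real \<Rightarrow> 'b" where
  "conv f t = integral {0..t} (\<lambda>s. T s (f (t - s)))"

lemma continuous_on_conv_integrand:
  assumes "continuous_on {0..b} f" "f ` {0..b} \<subseteq> H" "0 \<le> p" "q \<le> t" "t \<le> b" "b \<le> \<delta>"
  shows "continuous_on {p..q} (\<lambda>s. T s (f (t - s)))"
proof (rule continuous_on_T_compose)
  show "continuous_on {p..q} (\<lambda>s. f (t - s))"
    by (rule continuous_on_compose2[OF assms(1)]) (use assms in \<open>auto intro!: continuous_intros\<close>)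
  show "(\<lambda>s. f (t - s)) ` {p..q} \<subseteq> H"
    using assms by (auto intro!: assms(2)[THEN subsetD])
qed (use assms in \<open>auto intro!: continuous_intros\<close>)

lemma conv_integrand_has_integral:
  assumes "continuous_on {0..b} f" "f ` {0..b} \<subseteq> H" "0 \<le> p" "q \<le> t" "t \<le> b" "b \<le> \<delta>"
  shows "((\<lambda>s. T s (f (t - s))) has_integral integral {p..q} (\<lambda>s. T s (f (t - s)))) {p..q}"
  by (intro integrable_integral integrable_continuous_real continuous_on_conv_integrand[OF assms])

lemma conv_0 [simp]: "conv f 0 = 0"
  by (simp add: conv_def)

lemma conv_integrand_integral_in:
  assumes "continuous_on {0..b} f" "f ` {0..b} \<subseteq> H" "0 \<le> p" "q \<le> t" "t \<le> b" "b \<le> \<delta>"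
  shows "integral {p..q} (\<lambda>s. T s (f (t - s))) \<in> H"
proof (rule has_integral_in_closed_subspace[OF subspace_H closed_H conv_integrand_has_integral[OF assms]])
  fix s assume "s \<in> {p..q}"
  then have "t - s \<in> {0..b}" "0 \<le> s" using assms by auto
  then show "T s (f (t - s)) \<in> H" using assms(2) by (intro T_in) blast+
qed

lemma conv_in:
  assumes "continuous_on {0..b} f" "f ` {0..b} \<subseteq> H" "t \<le> b" "b \<le> \<delta>"
  shows "conv f t \<in> H"
  unfolding conv_def using assms by (intro conv_integrand_integral_in[of b]) auto

text \<open>
  Restarting the variation of constants formula at the intermediate time \<open>a\<close>.
\<close>

lemma conv_split:
  assumes f: "continuous_on {0..b} f" "f ` {0..b} \<subseteq> H" and t: "0 \<le> a" "a \<le> t" "t \<le> b" "b \<le> \<delta>"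
  shows "conv f t = T (t - a) (conv f a) + integral {0..t - a} (\<lambda>s. T s (f (t - s)))"
proof -
  let ?g = "\<lambda>s. T s (f (t - s))"
  have "((\<lambda>s. T (t - a) (T s (f (a - s)))) has_integral T (t - a) (conv f a)) {0..a}"
    unfolding conv_def
  proof (rule has_integral_bounded_linear_on[OF subspace_H closed_H T_bounded_linear])
    show "continuous_on {0..a} (\<lambda>s. T s (f (a - s)))"
      using t by (intro continuous_on_conv_integrand[OF f]) auto
    fix s assume "s \<in> {0..a}"
    then have "a - s \<in> {0..b}" "0 \<le> s" using t by auto
    then show "T s (f (a - s)) \<in> H" using f(2) by (intro T_in) blast+
  qed (use t in auto)
  then have "((\<lambda>s. ?g (s + (t - a))) has_integral T (t - a) (conv f a)) {0..a}"
  proof (rule has_integral_eq[rotated])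
    fix s assume s: "s \<in> {0..a}"
    then have "a - s \<in> {0..b}" using t by auto
    then have "f (a - s) \<in> H" using f(2) by blast
    then show "T (t - a) (T s (f (a - s))) = ?g (s + (t - a))"
      using s t T_plus[of "t - a" s "f (a - s)"] by (simp add: add.commute)
  qed
  then have "(?g has_integral T (t - a) (conv f a)) {t - a..t}"
    using has_integral_shift_real_ivl_iff[of ?g _ "t - a" t "t - a"] by simp
  moreover have "(?g has_integral integral {0..t - a} ?g) {0..t - a}"
    using t by (intro conv_integrand_has_integral[OF f]) auto
  ultimately have "(?g has_integral integral {0..t - a} ?g + T (t - a) (conv f a)) {0..t}"
    using has_integral_combine[of 0 "t - a" t ?g] t by auto
  then show ?thesis
    unfolding conv_def[of f t] by (simp add: integral_unique add.commute)
qed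

text \<open>
  The Lipschitz constant \<open>L\<close> of the forcing enters only with the factor \<open>b\<close>. On a short time interval the Lipschitz
  constant of the Duhamel integral is therefore controlled by the supremum of the forcing alone. This
  is what makes a class of uniformly Lipschitz functions invariant under the fixed point map.
\<close>

lemma norm_conv_diff_le:
  assumes f: "continuous_on {0..b} f" "f ` {0..b} \<subseteq> H" and b: "b \<le> \<delta>"
    and L: "\<And>s t. s \<in> {0..b} \<Longrightarrow> t \<in> {0..b} \<Longrightarrow> norm (f t - f s) \<le> L * \<bar>t - s\<bar>"
    and N: "\<And>s. s \<in> {0..b} \<Longrightarrow> norm (f s) \<le> N"
    and st: "0 \<le> s" "s \<le> t" "t \<le> b"
  shows "norm (conv f t - conv f s) \<le> (K * L * b + K * N) * (t - s)"
proof -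
  let ?g = "\<lambda>t \<tau>. T \<tau> (f (t - \<tau>))"
  have "(?g t has_integral integral {0..s} (?g t)) {0..s}"
    using st b by (intro conv_integrand_has_integral[OF f]) auto
  moreover have "(?g s has_integral conv f s) {0..s}"
    unfolding conv_def using st b by (intro conv_integrand_has_integral[OF f]) auto
  ultimately have "((\<lambda>\<tau>. ?g t \<tau> - ?g s \<tau>) has_integral integral {0..s} (?g t) - conv f s) {0..s}"
    by (rule has_integral_diff)
  then have "norm (integral {0..s} (?g t) - conv f s) \<le> K * (L * (t - s)) * (s - 0)"
  proof (rule norm_has_integral_le)
    fix \<tau> assume \<tau>: "0 \<le> \<tau>" "\<tau> \<le> s"
    then have *: "t - \<tau> \<in> {0..b}" "s - \<tau> \<in> {0..b}" using st by auto
    then have "?g t \<tau> - ?g s \<tau> = T \<tau> (f (t - \<tau>) - f (s - \<tau>))"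
      using \<tau> f(2) by (subst T_diff) blast+
    also have "norm \<dots> \<le> K * norm (f (t - \<tau>) - f (s - \<tau>))"
      using \<tau> * f(2) st b by (intro norm_T_le subspace_diff[OF subspace_H]) auto
    also have "\<dots> \<le> K * (L * (t - s))"
      using L[OF *(2,1)] K_pos st by (intro mult_left_mono) auto
    finally show "norm (?g t \<tau> - ?g s \<tau>) \<le> K * (L * (t - s))" .
  qed (use st in auto)
  moreover have "norm (integral {s..t} (?g t)) \<le> K * N * (t - s)"
  proof (rule norm_has_integral_le)
    show "(?g t has_integral integral {s..t} (?g t)) {s..t}"
      using st b by (intro conv_integrand_has_integral[OF f]) auto
    fix \<tau> assume \<tau>: "s \<le> \<tau>" "\<tau> \<le> t"
    then have *: "t - \<tau> \<in> {0..b}" using st by auto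
    then have "norm (?g t \<tau>) \<le> K * norm (f (t - \<tau>))"
      using f(2) \<tau> st b by (intro norm_T_le) auto
    also have "\<dots> \<le> K * N"
      using N[OF *] K_pos by (intro mult_left_mono) auto
    finally show "norm (?g t \<tau>) \<le> K * N" .
  qed (use st in auto)
  moreover have "conv f t = integral {0..s} (?g t) + integral {s..t} (?g t)"
  proof -
    have "?g t integrable_on {0..t}"
      using st b by (intro integrable_continuous_real continuous_on_conv_integrand[OF f]) auto
    then show ?thesis
      unfolding conv_def by (rule Henstock_Kurzweil_Integration.integral_combine[OF st(1,2), symmetric])
  qed
  ultimately have "norm (conv f t - conv f s) \<le> K * (L * (t - s)) * s + K * N * (t - s)"
    using norm_triangle_ineq[of "integral {0..s} (?g t) - conv f s" "integral {s..t} (?g t)"]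
    by (simp add: algebra_simps)
  moreover have "K * (L * (t - s)) * s \<le> K * (L * (t - s)) * b"
  proof (rule mult_left_mono)
    have "0 \<le> norm (f t - f s)" by simp
    also have "\<dots> \<le> L * (t - s)" using L[of s t] st by auto
    finally show "0 \<le> K * (L * (t - s))" using K_pos by simp
  qed (use st in auto)
  ultimately show ?thesis by (simp add: algebra_simps)
qed

lemma T_conv_in_D:
  assumes "continuous_on {0..b} f" "f ` {0..b} \<subseteq> H" "0 < \<epsilon>" "\<epsilon> \<le> \<delta>" "t \<le> b" "b \<le> \<delta>"
  shows "T \<epsilon> (conv f t) \<in> D"
  using assms by (intro T_in_D conv_in)

text \<open>
  \<open>T \<epsilon> (conv f (t - \<epsilon>))\<close> is the Duhamel integral without the singular piece \<open>{0..\<epsilon>}\<close>. Applying \<open>G\<close> to it and comparing two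
  values of \<open>\<epsilon>\<close> leaves \<open>\<integral> G (T s (f (t - s)))\<close> over \<open>{\<epsilon>'..\<epsilon>}\<close>. The singularity \<open>K / s\<close> is not integrable,
  but adding \<open>T \<epsilon> (f t)\<close> subtracts \<open>\<integral> G (T s (f t))\<close>, and then the factor \<open>L * s\<close> from the Lipschitz condition cancels it.
\<close>

lemma norm_regularised_diff_le:
  assumes f: "continuous_on {0..b} f" "f ` {0..b} \<subseteq> H" and b: "b \<le> \<delta>"
    and L: "\<And>s t. s \<in> {0..b} \<Longrightarrow> t \<in> {0..b} \<Longrightarrow> norm (f t - f s) \<le> L * \<bar>t - s\<bar>"
    and \<epsilon>: "0 < \<epsilon>'" "\<epsilon>' \<le> \<epsilon>" "\<epsilon> \<le> t" "t \<le> b"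
  shows "norm ((G (T \<epsilon>' (conv f (t - \<epsilon>'))) + T \<epsilon>' (f t)) - (G (T \<epsilon> (conv f (t - \<epsilon>))) + T \<epsilon> (f t)))
       \<le> K * L * (\<epsilon> - \<epsilon>')"
proof -
  have ft: "f s \<in> H" if "0 \<le> s" "s \<le> b" for s
    using f(2) that by auto
  let ?g = "\<lambda>s. T s (f (t - \<epsilon>' - s))"
  let ?I = "integral {0..\<epsilon> - \<epsilon>'} ?g"
  have I: "?I \<in> H"
    using \<epsilon> b by (intro conv_integrand_integral_in[OF f]) auto
  have cH: "conv f (t - \<epsilon>) \<in> H"
    using \<epsilon> b by (intro conv_in[OF f]) auto
  have "conv f (t - \<epsilon>') = T (\<epsilon> - \<epsilon>') (conv f (t - \<epsilon>)) + ?I"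
    using conv_split[OF f, of "t - \<epsilon>" "t - \<epsilon>'"] \<epsilon> b by simp
  then have "T \<epsilon>' (conv f (t - \<epsilon>')) = T \<epsilon> (conv f (t - \<epsilon>)) + T \<epsilon>' ?I"
    using T_plus[of \<epsilon>' "\<epsilon> - \<epsilon>'" "conv f (t - \<epsilon>)"] \<epsilon> cH I by (simp add: T_add T_in)
  then have G: "G (T \<epsilon>' (conv f (t - \<epsilon>'))) - G (T \<epsilon> (conv f (t - \<epsilon>))) = G (T \<epsilon>' ?I)"
    using \<epsilon> b cH I by (simp add: G_add T_in_D)
  have "((\<lambda>s. G (T \<epsilon>' (?g s))) has_integral G (T \<epsilon>' ?I)) {0..\<epsilon> - \<epsilon>'}"
  proof (rule has_integral_bounded_linear_on[OF subspace_H closed_H G_T_bounded_linear])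
    show "continuous_on {0..\<epsilon> - \<epsilon>'} ?g"
      using \<epsilon> b by (intro continuous_on_conv_integrand[OF f]) auto
    show "?g s \<in> H" if "s \<in> {0..\<epsilon> - \<epsilon>'}" for s
      using that \<epsilon> by (intro T_in ft) auto
  qed (use \<epsilon> b in auto)
  then have 1: "((\<lambda>s. G (T (s + \<epsilon>') (f (t - (s + \<epsilon>'))))) has_integral G (T \<epsilon>' ?I)) {0..\<epsilon> - \<epsilon>'}"
  proof (rule has_integral_eq[rotated])
    fix s assume s: "s \<in> {0..\<epsilon> - \<epsilon>'}"
    have "T (\<epsilon>' + s) (f (t - \<epsilon>' - s)) = T \<epsilon>' (?g s)"
      using s \<epsilon> by (intro T_plus ft) auto
    then show "G (T \<epsilon>' (?g s)) = G (T (s + \<epsilon>') (f (t - (s + \<epsilon>'))))"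
      by (simp add: add.commute diff_diff_eq)
  qed
  have "((\<lambda>s. G (T s (f t))) has_integral T \<epsilon> (f t) - T \<epsilon>' (f t)) {\<epsilon>'..\<epsilon>}"
    using \<epsilon> b by (intro T_diff_has_integral ft) auto
  moreover have "((\<lambda>s. G (T s (f (t - s)))) has_integral G (T \<epsilon>' ?I)) {\<epsilon>'..\<epsilon>}"
    using 1 has_integral_shift_real_ivl_iff[of "\<lambda>s. G (T s (f (t - s)))" _ \<epsilon>' \<epsilon> \<epsilon>'] by simp
  ultimately have "((\<lambda>s. G (T s (f (t - s))) - G (T s (f t))) has_integral
      G (T \<epsilon>' ?I) - (T \<epsilon> (f t) - T \<epsilon>' (f t))) {\<epsilon>'..\<epsilon>}"
    by (intro has_integral_diff)
  then have "norm (G (T \<epsilon>' ?I) - (T \<epsilon> (f t) - T \<epsilon>' (f t))) \<le> K * L * (\<epsilon> - \<epsilon>')"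
  proof (rule norm_has_integral_le)
    fix s assume s: "\<epsilon>' \<le> s" "s \<le> \<epsilon>"
    then have s': "0 < s" "s \<le> \<delta>" "0 \<le> t - s" "t - s \<le> b" "0 \<le> t" using \<epsilon> b by auto
    have "G (T s (f (t - s))) - G (T s (f t)) = G (T s (f (t - s) - f t))"
      using bounded_linear_on_diff[OF subspace_H G_T_bounded_linear[OF s'(1,2)]] s' \<epsilon> ft by simp
    also have "norm \<dots> \<le> K / s * norm (f (t - s) - f t)"
      using s' \<epsilon> by (intro norm_G_T_le subspace_diff[OF subspace_H] ft) auto
    also have "\<dots> \<le> K / s * (L * s)"
      using L[of t "t - s"] s' \<epsilon> K_pos by (intro mult_left_mono) auto
    also have "\<dots> = K * L"
      using s' by simp
    finally show "norm (G (T s (f (t - s))) - G (T s (f t))) \<le> K * L" .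
  qed (use \<epsilon> in auto)
  then show ?thesis
    using G by (simp add: algebra_simps)
qed

text \<open>
  The regularised expressions of \<open>norm_regularised_diff_le\<close> form a Cauchy family as \<open>\<epsilon>\<close> tends to \<open>0\<close>, so closedness of
  the generator applies. The estimate keeps track of the rate, which does not depend on \<open>t\<close>.
\<close>

lemma conv_regular:
  assumes f: "continuous_on {0..b} f" "f ` {0..b} \<subseteq> H" and b: "b \<le> \<delta>"
    and L: "\<And>s t. s \<in> {0..b} \<Longrightarrow> t \<in> {0..b} \<Longrightarrow> norm (f t - f s) \<le> L * \<bar>t - s\<bar>"
    and cont: "continuous_on {0..b} (conv f)"
    and t: "0 < t" "t \<le> b"
  shows conv_in_D: "conv f t \<in> D"
    and norm_G_conv_le: "0 < \<epsilon> \<Longrightarrow> \<epsilon> \<le> t \<Longrightarrow>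
      norm (G (conv f t) + f t - (G (T \<epsilon> (conv f (t - \<epsilon>))) + T \<epsilon> (f t))) \<le> K * L * \<epsilon>"
proof -
  define q where "q \<epsilon> = G (T \<epsilon> (conv f (t - \<epsilon>))) + T \<epsilon> (f t)" for \<epsilon>
  have q: "norm (q \<epsilon>' - q \<epsilon>) \<le> K * L * (\<epsilon> - \<epsilon>')" if "0 < \<epsilon>'" "\<epsilon>' \<le> \<epsilon>" "\<epsilon> \<le> t" for \<epsilon> \<epsilon>'
    unfolding q_def using norm_regularised_diff_le[OF f b L that t(2)] by blast
  have ft: "f t \<in> H" using f(2) t by auto
  have KL: "0 \<le> K * L"
  proof -
    have "0 \<le> norm (f t - f 0)" by simp
    also have "\<dots> \<le> L * t" using L[of 0 t] t by auto
    finally show ?thesis using t K_pos by (simp add: zero_le_mult_iff)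
  qed
  define e where "e n = t * inverse (real (Suc n))" for n
  have e: "0 < e n" "e n \<le> t" for n
    using t by (auto simp: e_def divide_simps)
  then have e_\<delta>: "e n \<in> {0..\<delta>}" for n
    using t b by (meson atLeastAtMost_iff less_imp_le order_trans)
  have e0: "e \<longlonglongrightarrow> 0"
    unfolding e_def by (rule tendsto_mult_right_zero[OF LIMSEQ_inverse_real_of_nat])
  have dist_q: "dist (q (e m)) (q (e n)) \<le> K * L * \<bar>e m - e n\<bar>" for m n
    using q[of "e m" "e n"] q[of "e n" "e m"] e
    by (cases "e m \<le> e n") (auto simp: dist_norm norm_minus_commute)
  have "Cauchy (\<lambda>n. q (e n))"
  proof (rule metric_CauchyI)
    fix r :: real assume r: "r > 0"
    then have "r / (K * L + 1) > 0" using KL by simp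
    then obtain M where M: "\<And>m n. m \<ge> M \<Longrightarrow> n \<ge> M \<Longrightarrow> dist (e m) (e n) < r / (K * L + 1)"
      using LIMSEQ_imp_Cauchy[OF e0] unfolding Cauchy_def by meson
    have "dist (q (e m)) (q (e n)) < r" if "m \<ge> M" "n \<ge> M" for m n
    proof -
      have "dist (q (e m)) (q (e n)) \<le> K * L * \<bar>e m - e n\<bar>" by (rule dist_q)
      also have "\<dots> \<le> (K * L + 1) * \<bar>e m - e n\<bar>" by (intro mult_right_mono) auto
      also have "\<dots> < r" using M[OF that] KL by (simp add: dist_real_def field_simps)
      finally show ?thesis .
    qed
    then show "\<exists>M. \<forall>m\<ge>M. \<forall>n\<ge>M. dist (q (e m)) (q (e n)) < r" by blast
  qed
  then obtain y where y: "(\<lambda>n. q (e n)) \<longlonglongrightarrow> y"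
    using Cauchy_convergent_iff convergent_def by blast
  have Tft: "(\<lambda>n. T (e n) (f t)) \<longlonglongrightarrow> f t"
  proof -
    have "(\<lambda>n. T (e n) (f t)) \<longlonglongrightarrow> T 0 (f t)"
      by (rule tendsto_T[OF e0 _ _ tendsto_const]) (use e_\<delta> \<delta>_pos ft in auto)
    then show ?thesis using ft by (simp add: T_0)
  qed
  have conv_t: "conv f t \<in> H" by (rule conv_in[OF f t(2) b])
  have "(\<lambda>n. T (e n) (conv f (t - e n))) \<longlonglongrightarrow> T 0 (conv f t)"
  proof (rule tendsto_T[OF e0])
    show "\<forall>\<^sub>F n in sequentially. e n \<in> {0..\<delta>}"
      using e_\<delta> by simp
    show "(\<lambda>n. conv f (t - e n)) \<longlonglongrightarrow> conv f t"
    proof (rule continuous_on_tendsto_compose[OF cont])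
      show "(\<lambda>n. t - e n) \<longlonglongrightarrow> t" using tendsto_diff[OF tendsto_const e0] by simp
      have "t - e n \<in> {0..b}" for n
        using e[of n] t by auto
      then show "\<forall>\<^sub>F n in sequentially. t - e n \<in> {0..b}" by simp
    qed (use t in auto)
    have "conv f (t - e n) \<in> H" for n
      using e[of n] t b by (intro conv_in[OF f]) auto
    then show "\<forall>\<^sub>F n in sequentially. conv f (t - e n) \<in> H" by simp
  qed (use \<delta>_pos conv_t in auto)
  then have "(\<lambda>n. T (e n) (conv f (t - e n))) \<longlonglongrightarrow> conv f t"
    using conv_t by (simp add: T_0)
  moreover have "T (e n) (conv f (t - e n)) \<in> D" for n
    using e[of n] t b by (intro T_conv_in_D[OF f]) auto
  moreover have "(\<lambda>n. G (T (e n) (conv f (t - e n)))) \<longlonglongrightarrow> y - f t"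
    using tendsto_diff[OF y Tft] by (simp add: q_def)
  ultimately have D: "conv f t \<in> D" and G: "G (conv f t) = y - f t"
    using G_closed[of "\<lambda>n. T (e n) (conv f (t - e n))"] by blast+
  show "conv f t \<in> D" by (rule D)
  show "norm (G (conv f t) + f t - (G (T \<epsilon> (conv f (t - \<epsilon>))) + T \<epsilon> (f t))) \<le> K * L * \<epsilon>"
    if \<epsilon>: "0 < \<epsilon>" "\<epsilon> \<le> t"
  proof -
    have "norm (y - q \<epsilon>) \<le> K * L * \<epsilon>"
    proof (rule tendsto_upperbound[OF tendsto_norm[OF tendsto_diff[OF y tendsto_const]]])
      have "\<forall>\<^sub>F n in sequentially. e n < \<epsilon>"
        using e0 \<epsilon> by (intro order_tendstoD(2)) auto
      then show "\<forall>\<^sub>F n in sequentially. norm (q (e n) - q \<epsilon>) \<le> K * L * \<epsilon>"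
      proof eventually_elim
        case (elim n)
        have "norm (q (e n) - q \<epsilon>) \<le> K * L * (\<epsilon> - e n)"
          using elim \<epsilon> e by (intro q) auto
        also have "\<dots> \<le> K * L * \<epsilon>"
          using KL e[of n] by (intro mult_left_mono) auto
        finally show ?case .
      qed
    qed auto
    then show ?thesis using G by (simp add: q_def)
  qed
qed

text \<open>
  By \<open>norm_G_conv_le\<close> this function is, up to the continuous term \<open>f\<close>, a locally uniform limit of
  continuous functions.
\<close>

lemma continuous_on_G_conv:
  assumes f: "continuous_on {0..b} f" "f ` {0..b} \<subseteq> H" and b: "b \<le> \<delta>"
    and L: "\<And>s t. s \<in> {0..b} \<Longrightarrow> t \<in> {0..b} \<Longrightarrow> norm (f t - f s) \<le> L * \<bar>t - s\<bar>"
    and cont: "continuous_on {0..b} (conv f)"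
  shows "continuous_on {0<..<b} (\<lambda>t. G (conv f t))"
proof -
  have "isCont (\<lambda>t. G (conv f t) + f t) t" if t: "0 < t" "t < b" for t
  proof -
    define q where "q \<epsilon> t = G (T \<epsilon> (conv f (t - \<epsilon>))) + T \<epsilon> (f t)" for \<epsilon> t
    have qc: "isCont (q \<epsilon>) t" if "0 < \<epsilon>" "\<epsilon> < t" for \<epsilon>
    proof -
      have "continuous_on {\<epsilon><..<b} (\<lambda>t. G (T \<epsilon> (conv f (t - \<epsilon>))))"
      proof (rule continuous_on_compose2[OF bounded_linear_on_continuous[OF subspace_H G_T_bounded_linear]])
        show "continuous_on {\<epsilon><..<b} (\<lambda>t. conv f (t - \<epsilon>))"
          using that by (intro continuous_on_compose2[OF cont] continuous_intros) auto
        show "(\<lambda>t. conv f (t - \<epsilon>)) ` {\<epsilon><..<b} \<subseteq> H"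
          using that b by (auto intro!: conv_in[OF f])
      qed (use that t b in auto)
      moreover have "continuous_on {\<epsilon><..<b} (\<lambda>t. T \<epsilon> (f t))"
        using that t b f(2)
        by (intro continuous_on_T_compose continuous_on_subset[OF f(1)] continuous_intros) auto
      ultimately have "continuous_on {\<epsilon><..<b} (q \<epsilon>)"
        unfolding q_def by (rule continuous_on_add)
      then show ?thesis
        using that t by (simp add: continuous_on_eq_continuous_at)
    qed
    define \<kappa> where "\<kappa> = \<bar>K * L\<bar> + 1"
    have \<kappa>: "\<kappa> > 0" "K * L \<le> \<kappa>" by (auto simp: \<kappa>_def)
    have approx: "dist (G (conv f s) + f s) (q \<epsilon> s) \<le> \<kappa> * \<epsilon>" if "0 < \<epsilon>" "\<epsilon> < s" "s < b" for \<epsilon> s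
    proof -
      have "dist (G (conv f s) + f s) (q \<epsilon> s) \<le> K * L * \<epsilon>"
        unfolding q_def dist_norm using that by (intro norm_G_conv_le[OF f b L cont]) auto
      also have "\<dots> \<le> \<kappa> * \<epsilon>" using \<kappa> that by (intro mult_right_mono) auto
      finally show ?thesis .
    qed
    show ?thesis
      unfolding continuous_at_eps_delta
    proof (intro allI impI)
      fix r :: real assume r: "r > 0"
      define \<epsilon> where "\<epsilon> = min (t / 2) (r / (3 * \<kappa>))"
      have \<epsilon>: "0 < \<epsilon>" "\<epsilon> < t" "\<kappa> * \<epsilon> \<le> r / 3"
        using t r \<kappa> by (auto simp: \<epsilon>_def min_def field_simps)
      obtain d where d: "d > 0" "\<And>s. dist s t < d \<Longrightarrow> dist (q \<epsilon> s) (q \<epsilon> t) < r / 3"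
        using qc[OF \<epsilon>(1,2)] r unfolding continuous_at_eps_delta by (metis zero_less_divide_iff zero_less_numeral)
      have "dist (G (conv f s) + f s) (G (conv f t) + f t) < r"
        if "dist s t < min d (min (t - \<epsilon>) (b - t))" for s
      proof -
        have "\<epsilon> < s" "s < b" using that by (auto simp: dist_real_def)
        then have "dist (G (conv f s) + f s) (q \<epsilon> s) \<le> r / 3" "dist (G (conv f t) + f t) (q \<epsilon> t) \<le> r / 3"
          using approx[of \<epsilon> s] approx[of \<epsilon> t] \<epsilon> t by auto
        moreover have "dist (q \<epsilon> s) (q \<epsilon> t) < r / 3" using d(2) that by auto
        ultimately show ?thesis
          using dist_triangle_less_add dist_triangle3 by metric
      qed
      then show "\<exists>d>0. \<forall>s. dist s t < d \<longrightarrow> dist (G (conv f s) + f s) (G (conv f t) + f t) < r"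
        using d(1) \<epsilon> t by (intro exI[of _ "min d (min (t - \<epsilon>) (b - t))"]) auto
    qed
  qed
  then have "continuous_on {0<..<b} (\<lambda>t. G (conv f t) + f t)"
    by (simp add: continuous_at_imp_continuous_on)
  then have "continuous_on {0<..<b} (\<lambda>t. (G (conv f t) + f t) - f t)"
    by (intro continuous_on_diff continuous_on_subset[OF f(1)]) auto
  then show ?thesis by simp
qed

section \<open>Mild and classical solutions\<close>

text \<open>
  Over a short interval from \<open>p\<close> to \<open>q\<close> the increment of \<open>u\<close> is the integral of
  \<open>T s (G (u p) + f (q - s))\<close>, and the integrand is uniformly close to \<open>G (u t) + f t\<close> when both end points are near \<open>t\<close>.
  Taking \<open>p = t\<close> or \<open>q = t\<close> gives the two one-sided derivatives; the left one uses continuity of \<open>G (u t)\<close>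
  in \<open>t\<close>.
\<close>

lemma mild_has_vector_derivative:
  assumes f: "continuous_on {0..b} f" "f ` {0..b} \<subseteq> H" and b: "b \<le> \<delta>"
    and mild: "\<And>p q. 0 < p \<Longrightarrow> p \<le> q \<Longrightarrow> q < b \<Longrightarrow>
      u q = T (q - p) (u p) + integral {0..q - p} (\<lambda>s. T s (f (q - s)))"
    and D: "\<And>t. 0 < t \<Longrightarrow> t < b \<Longrightarrow> u t \<in> D"
    and cont: "continuous_on {0<..<b} (\<lambda>t. G (u t))"
    and t: "0 < t" "t < b"
  shows "(u has_vector_derivative G (u t) + f t) (at t)"
proof -
  let ?c = "G (u t) + f t"
  have fH: "f s \<in> H" if "0 \<le> s" "s \<le> b" for s using f(2) that by auto
  have c: "?c \<in> H" using t by (intro subspace_add[OF subspace_H] G_in D fH) auto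
  have "\<exists>d>0. \<forall>y. norm (y - t) < d \<longrightarrow> norm (u y - u t - (y - t) *\<^sub>R ?c) \<le> e * norm (y - t)"
    if e: "e > 0" for e
  proof -
    \<comment> \<open>The moduli of continuity of \<open>G (u t)\<close> and \<open>f\<close> contribute \<open>K * (\<eta> + \<eta>)\<close>, strong continuity at \<open>?c\<close> contributes \<open>\<eta>\<close>.\<close>
    define \<eta> where "\<eta> = e / (2 * K + 1)"
    have \<eta>: "\<eta> > 0" "K * (\<eta> + \<eta>) + \<eta> = e"
    proof -
      show "\<eta> > 0" using e K_pos by (simp add: \<eta>_def)
      have "(2 * K + 1) * \<eta> = e" using K_pos by (simp add: \<eta>_def)
      then show "K * (\<eta> + \<eta>) + \<eta> = e" by (simp add: algebra_simps)
    qed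
    have "isCont (\<lambda>t. G (u t)) t"
      using cont t by (simp add: continuous_on_eq_continuous_at)
    then obtain d1 where d1: "d1 > 0" "\<And>s. dist s t < d1 \<Longrightarrow> dist (G (u s)) (G (u t)) < \<eta>"
      using \<eta> unfolding continuous_at_eps_delta by blast
    have "continuous_on {0<..<b} f" by (rule continuous_on_subset[OF f(1)]) auto
    then have "isCont f t"
      using t by (simp add: continuous_on_eq_continuous_at)
    then obtain d2 where d2: "d2 > 0" "\<And>s. dist s t < d2 \<Longrightarrow> dist (f s) (f t) < \<eta>"
      using \<eta> unfolding continuous_at_eps_delta by blast
    have "((\<lambda>s. T s ?c) \<longlongrightarrow> ?c) (at_right 0)"
      using semigroup c by (simp add: C0_semigroup_on_def)
    then have "\<forall>\<^sub>F s in at_right 0. dist (T s ?c) ?c < \<eta>"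
      using \<eta> by (intro tendstoD) auto
    then obtain d3 where d3: "d3 > 0" "\<And>s. 0 < s \<Longrightarrow> s < d3 \<Longrightarrow> dist (T s ?c) ?c < \<eta>"
      unfolding eventually_at_right_field by auto
    define d where "d = min (min d1 d2) (min d3 (min t (b - t)))"
    have d: "d > 0" using d1 d2 d3 t by (auto simp: d_def)
    have main: "norm (u q - u p - (q - p) *\<^sub>R ?c) \<le> e * (q - p)"
      if pq: "p \<le> q" and near: "t - d < p" "q < t + d" "q - p < d" for p q
    proof -
      have pq': "0 < p" "q < b" using near by (auto simp: d_def)
      let ?I = "integral {0..q - p} (\<lambda>s. T s (f (q - s)))"
      have I: "((\<lambda>s. T s (f (q - s))) has_integral ?I) {0..q - p}"
        using pq pq' b by (intro conv_integrand_has_integral[OF f]) auto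
      have "((\<lambda>s. T s (G (u p))) has_integral T (q - p) (u p) - T 0 (u p)) {0..q - p}"
        using pq pq' b by (intro T_diff_has_integral_D D) auto
      then have "((\<lambda>s. T s (G (u p))) has_integral T (q - p) (u p) - u p) {0..q - p}"
        using pq pq' by (simp add: T_0 D D_subset)
      from has_integral_add[OF this I]
      have "((\<lambda>s. T s (G (u p)) + T s (f (q - s))) has_integral u q - u p) {0..q - p}"
        using mild[of p q] pq pq' by (simp add: algebra_simps)
      from has_integral_diff[OF this has_integral_const_real[of ?c 0 "q - p"]]
      have "((\<lambda>s. T s (G (u p)) + T s (f (q - s)) - ?c) has_integral u q - u p - (q - p) *\<^sub>R ?c) {0..q - p}"
        using pq by simp
      then have "norm (u q - u p - (q - p) *\<^sub>R ?c) \<le> e * (q - p - 0)"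
      proof (rule norm_has_integral_le)
        fix s assume s: "0 \<le> s" "s \<le> q - p"
        have s': "0 \<le> q - s" "q - s \<le> b" "s \<le> \<delta>" using s pq' b by auto
        let ?x = "(G (u p) - G (u t)) + (f (q - s) - f t)"
        have x: "?x \<in> H"
          using pq pq' t s'
          by (intro subspace_add[OF subspace_H] subspace_diff[OF subspace_H] G_in D fH) auto
        have "T s ?x + T s ?c = T s (?x + ?c)"
          by (rule T_add[OF s(1) x c, symmetric])
        also have "?x + ?c = G (u p) + f (q - s)" by simp
        also have "T s \<dots> = T s (G (u p)) + T s (f (q - s))"
          using pq pq' s s' by (intro T_add G_in D fH) auto
        finally have eq: "T s (G (u p)) + T s (f (q - s)) - ?c = T s ?x + (T s ?c - ?c)"
          by (simp only: algebra_simps)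
        have "dist p t < d1" "dist (q - s) t < d2"
          using near s pq by (auto simp: d_def dist_real_def)
        then have "norm (G (u p) - G (u t)) \<le> \<eta>" "norm (f (q - s) - f t) \<le> \<eta>"
          using d1(2) d2(2) by (auto simp: dist_norm intro: less_imp_le)
        then have "norm ?x \<le> \<eta> + \<eta>" by (intro norm_triangle_mono)
        then have "norm (T s ?x) \<le> K * (\<eta> + \<eta>)"
          using norm_T_le[OF s(1) s'(3) x] K_pos by (meson mult_left_mono less_imp_le order_trans)
        moreover have "norm (T s ?c - ?c) \<le> \<eta>"
        proof (cases "s = 0")
          case False
          then have "dist (T s ?c) ?c < \<eta>" using s near by (intro d3) (auto simp: d_def)
          then show ?thesis by (simp add: dist_norm)
        qed (use c \<eta> in \<open>simp add: T_0\<close>)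
        ultimately show "norm (T s (G (u p)) + T s (f (q - s)) - ?c) \<le> e"
          unfolding eq \<eta>(2)[symmetric] by (rule norm_triangle_mono)
      qed (use pq in auto)
      then show ?thesis by simp
    qed
    have "norm (u y - u t - (y - t) *\<^sub>R ?c) \<le> e * norm (y - t)" if y: "norm (y - t) < d" for y
    proof (cases "t \<le> y")
      case True
      then show ?thesis using main[of t y] y d by simp
    next
      case False
      have "u y - u t - (y - t) *\<^sub>R ?c = - (u t - u y - (t - y) *\<^sub>R ?c)"
        by (simp add: algebra_simps)
      then have "norm (u y - u t - (y - t) *\<^sub>R ?c) = norm (u t - u y - (t - y) *\<^sub>R ?c)"
        by (simp only: norm_minus_cancel)
      then show ?thesis using False main[of y t] y d by simp
    qed
    then show ?thesis using d by blast
  qed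
  then show ?thesis
    unfolding has_vector_derivative_def has_derivative_within_alt
    by (auto simp: bounded_linear_scaleR_left)
qed

text \<open>
  The curve \<open>s \<mapsto> T s (v (t - s))\<close> has derivative \<open>- T s (f (t - s))\<close>, because the two terms with \<open>G\<close> cancel. The
  fundamental theorem of calculus is used in the form with interior derivatives, as \<open>v\<close> may fail to be differentiable
  at time \<open>0\<close>.
\<close>

lemma classical_imp_mild:
  assumes t: "0 \<le> t" "t \<le> \<delta>"
    and v: "continuous_on {0..t} v" "v ` {0..t} \<subseteq> H"
    and D: "\<And>s. 0 < s \<Longrightarrow> s < t \<Longrightarrow> v s \<in> D"
    and f: "\<And>s. 0 < s \<Longrightarrow> s < t \<Longrightarrow> f s \<in> H"
    and der: "\<And>s. 0 < s \<Longrightarrow> s < t \<Longrightarrow> (v has_vector_derivative G (v s) + f s) (at s)"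
  shows "((\<lambda>s. T s (f (t - s))) has_integral v t - T t (v 0)) {0..t}"
proof -
  let ?p = "\<lambda>s. T s (v (t - s))"
  have vH: "v s \<in> H" if "0 \<le> s" "s \<le> t" for s using v(2) that by auto
  have "((\<lambda>s. - T s (f (t - s))) has_integral ?p t - ?p 0) {0..t}"
  proof (rule fundamental_theorem_of_calculus_interior[OF t(1)])
    show "continuous_on {0..t} ?p"
      using continuous_on_conv_integrand[OF v, of 0 t t] t by simp
    fix s assume "s \<in> {0<..<t}"
    then have s: "0 < s" "s < t" "0 < t - s" "t - s < t" by auto
    let ?d = "G (v (t - s)) + f (t - s)"
    have d: "?d \<in> H" using s by (intro subspace_add[OF subspace_H] G_in D f) auto
    have "((\<lambda>h. (v (t - s + h) - v (t - s)) /\<^sub>R h) \<longlongrightarrow> ?d) (at 0)"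
      using der[OF s(3,4)] by (simp add: has_vector_derivative_difference_quotient)
    then have "((\<lambda>h. (v (t - s + - h) - v (t - s)) /\<^sub>R (- h)) \<longlongrightarrow> ?d) (at 0)"
    proof (rule filterlim_compose)
      show "filterlim uminus (at (0::real)) (at 0)"
        by (auto simp: filterlim_at eventually_at_filter intro!: tendsto_eq_intros)
    qed
    then have q: "((\<lambda>h. (v (t - (s + h)) - v (t - s)) /\<^sub>R (- h)) \<longlongrightarrow> ?d) (at 0)"
      by (simp add: algebra_simps)
    have nhd: "\<forall>\<^sub>F h in at (0::real). \<bar>h\<bar> < min s (t - s)"
      using s by (auto simp: eventually_at dist_real_def intro!: exI[of _ "min s (t - s)"])
    have "((\<lambda>h. T (s + h) ((v (t - (s + h)) - v (t - s)) /\<^sub>R (- h))) \<longlongrightarrow> T s ?d) (at 0)"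
    proof (rule tendsto_T[OF _ _ _ q])
      show "((\<lambda>h. s + h) \<longlongrightarrow> s) (at 0)"
        using tendsto_add[OF tendsto_const tendsto_ident_at, of s 0 UNIV] by simp
      show "\<forall>\<^sub>F h in at 0. s + h \<in> {0..\<delta>}"
        using nhd by eventually_elim (use s t in auto)
      show "\<forall>\<^sub>F h in at 0. (v (t - (s + h)) - v (t - s)) /\<^sub>R - h \<in> H"
        using nhd by eventually_elim
          (use s in \<open>auto intro!: subspace_neg[OF subspace_H] subspace_scale[OF subspace_H] subspace_diff[OF subspace_H] vH\<close>)
    qed (use s t d in auto)
    moreover have "((\<lambda>h. (T (s + h) (v (t - s)) - T s (v (t - s))) /\<^sub>R h) \<longlongrightarrow> G (T s (v (t - s)))) (at 0)"
      using T_has_vector_derivative[of s "v (t - s)"] s t vH[of "t - s"]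
      by (simp add: has_vector_derivative_difference_quotient)
    ultimately have "((\<lambda>h. - T (s + h) ((v (t - (s + h)) - v (t - s)) /\<^sub>R (- h))
        + (T (s + h) (v (t - s)) - T s (v (t - s))) /\<^sub>R h) \<longlongrightarrow> - T s ?d + G (T s (v (t - s)))) (at 0)"
      by (intro tendsto_add tendsto_minus)
    moreover have "\<forall>\<^sub>F h in at 0. - T (s + h) ((v (t - (s + h)) - v (t - s)) /\<^sub>R (- h))
        + (T (s + h) (v (t - s)) - T s (v (t - s))) /\<^sub>R h = (?p (s + h) - ?p s) /\<^sub>R h"
      using nhd
    proof eventually_elim
      case (elim h)
      then have "v (t - (s + h)) \<in> H" "v (t - s) \<in> H" "0 \<le> s + h"
        using s by (auto intro!: vH)
      then have "T (s + h) ((v (t - (s + h)) - v (t - s)) /\<^sub>R (- h)) = (?p (s + h) - T (s + h) (v (t - s))) /\<^sub>R (- h)"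
        by (simp only: T_scaleR T_diff subspace_diff[OF subspace_H])
      then show ?case
        by (simp add: scaleR_diff_right)
    qed
    ultimately have "((\<lambda>h. (?p (s + h) - ?p s) /\<^sub>R h) \<longlongrightarrow> - T s ?d + G (T s (v (t - s)))) (at 0)"
      by (rule Lim_transform_eventually)
    moreover have "- T s ?d + G (T s (v (t - s))) = - T s (f (t - s))"
      using s t by (simp add: T_add G_in D f G_T_commute)
    ultimately show "(?p has_vector_derivative - T s (f (t - s))) (at s)"
      by (simp add: has_vector_derivative_difference_quotient)
  qed
  from has_integral_neg[OF this] show ?thesis
    using t vH[of t] by (simp add: T_0)
qed

end

section \<open>Estimates for the delayed term\<close>

lemma sup_norm_le:
  assumes "0 < h" "\<And>s. s \<in> {-h..0} \<Longrightarrow> norm (\<psi> s) \<le> e"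
  shows "sup_norm h \<psi> \<le> e"
  unfolding sup_norm_def using assms by (intro cSUP_least) auto

lemma continuous_on_bcontfun_eval: "continuous_on S (\<lambda>u. apply_bcontfun u x)"
proof -
  have "1-lipschitz_on S (\<lambda>u. apply_bcontfun u x)"
    by (rule lipschitz_onI) (auto simp: dist_bounded)
  then show ?thesis by (rule lipschitz_on_continuous_on)
qed

locale delay_equation = smoothing_semigroup +
  fixes B :: "'a \<Rightarrow> 'a" and r :: "(real \<Rightarrow> 'a) \<Rightarrow> real" and h L\<^sub>B L\<^sub>r :: real
  assumes h_pos: "0 < h"
    and B_in: "x \<in> H \<Longrightarrow> B x \<in> H" and B_lipschitz: "L\<^sub>B-lipschitz_on H B"
    and r_range: "\<psi> \<in> C_space h H \<Longrightarrow> r \<psi> \<in> {0..h}"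
    and L\<^sub>r_nonneg: "0 \<le> L\<^sub>r"
    and r_lipschitz: "\<psi> \<in> C_space h H \<Longrightarrow> \<psi>' \<in> C_space h H \<Longrightarrow>
      \<bar>r \<psi> - r \<psi>'\<bar> \<le> L\<^sub>r * sup_norm h (\<lambda>s. \<psi> s - \<psi>' s)"
begin

abbreviation F :: "(real \<Rightarrow> 'a) \<Rightarrow> 'a" where
  "F \<equiv> delay_rhs B r"

lemma L\<^sub>B_nonneg: "0 \<le> L\<^sub>B"
  using B_lipschitz by (rule lipschitz_on_nonneg)

lemma history_in_C_space:
  assumes "continuous_on {-h..t} u" "u ` {-h..t} \<subseteq> H" "0 \<le> s" "s \<le> t"
  shows "history u s \<in> C_space h H"
proof -
  have "continuous_on {-h..0} (\<lambda>\<theta>. u (s + \<theta>))"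
    by (rule continuous_on_compose2[OF assms(1)]) (use assms in \<open>auto intro!: continuous_intros\<close>)
  moreover have "(\<lambda>\<theta>. u (s + \<theta>)) ` {-h..0} \<subseteq> H"
    using assms by (auto intro!: assms(2)[THEN subsetD])
  ultimately show ?thesis by (simp add: C_space_def history_def)
qed

lemma F_history: "F (history u t) = B (u (t - r (history u t)))"
  by (simp add: delay_rhs_def history_def)

lemma F_history_in:
  assumes "continuous_on {-h..t} u" "u ` {-h..t} \<subseteq> H" "0 \<le> t"
  shows "F (history u t) \<in> H"
proof -
  have "t - r (history u t) \<in> {-h..t}"
    using r_range[OF history_in_C_space[OF assms(1,2,3) order_refl]] assms(3) by auto
  then show ?thesis
    unfolding F_history using assms(2) by (intro B_in) blast
qed

text \<open>
  Along a Lipschitz function the state-dependent delay is itself Lipschitz in time, and so is the delayed term.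
\<close>

lemma norm_F_history_diff_le:
  assumes u: "M-lipschitz_on {-h..b} u" "u ` {-h..b} \<subseteq> H" and s: "s \<in> {0..b}" and t: "t \<in> {0..b}"
  shows "norm (F (history u t) - F (history u s)) \<le> L\<^sub>B * (M * (1 + L\<^sub>r * M)) * \<bar>t - s\<bar>"
proof -
  have cont: "continuous_on {-h..b} u" using u(1) by (rule lipschitz_on_continuous_on)
  have M: "0 \<le> M" using u(1) by (rule lipschitz_on_nonneg)
  have hs: "history u s \<in> C_space h H" and ht: "history u t \<in> C_space h H"
    using s t by (auto intro!: history_in_C_space[OF cont u(2)])
  have "sup_norm h (\<lambda>\<theta>. history u t \<theta> - history u s \<theta>) \<le> M * \<bar>t - s\<bar>"
  proof (rule sup_norm_le[OF h_pos])
    fix \<theta> assume "\<theta> \<in> {-h..0}"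
    then show "norm (history u t \<theta> - history u s \<theta>) \<le> M * \<bar>t - s\<bar>"
      using lipschitz_on_normD[OF u(1), of "t + \<theta>" "s + \<theta>"] s t by (simp add: history_def)
  qed
  then have "\<bar>r (history u t) - r (history u s)\<bar> \<le> L\<^sub>r * (M * \<bar>t - s\<bar>)"
    using r_lipschitz[OF ht hs] L\<^sub>r_nonneg by (meson mult_left_mono order_trans)
  then have "\<bar>(t - r (history u t)) - (s - r (history u s))\<bar> \<le> (1 + L\<^sub>r * M) * \<bar>t - s\<bar>"
    by (simp add: algebra_simps abs_if split: if_splits)
  moreover have in_t: "t - r (history u t) \<in> {-h..b}" and in_s: "s - r (history u s) \<in> {-h..b}"
    using r_range[OF ht] r_range[OF hs] s t by auto
  ultimately have "norm (u (t - r (history u t)) - u (s - r (history u s))) \<le> M * ((1 + L\<^sub>r * M) * \<bar>t - s\<bar>)"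
    using lipschitz_on_normD[OF u(1) in_t in_s] M by (simp del: atLeastAtMost_iff) (meson mult_left_mono order_trans)
  moreover have "norm (F (history u t) - F (history u s))
      \<le> L\<^sub>B * norm (u (t - r (history u t)) - u (s - r (history u s)))"
    unfolding F_history using in_t in_s u(2) by (intro lipschitz_on_normD[OF B_lipschitz]) blast+
  ultimately show ?thesis
    using L\<^sub>B_nonneg by (simp add: mult.assoc) (meson mult_left_mono order_trans)
qed

text \<open>
  The delayed term is in general not locally Lipschitz on the whole history space, since a change of the delay shifts the
  argument of the history. It suffices, however, that one of the two functions be Lipschitz: the
  shift of the argument is charged to \<open>u\<close>. This asymmetry is what makes uniqueness provable among all classical
  solutions, which are not known in advance to be Lipschitz up to time \<open>0\<close>.
\<close>

lemma norm_F_history_compare: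
  assumes u: "M-lipschitz_on {-h..t} u" "u ` {-h..t} \<subseteq> H"
    and v: "continuous_on {-h..t} v" "v ` {-h..t} \<subseteq> H"
    and e: "\<And>s. s \<in> {-h..t} \<Longrightarrow> norm (u s - v s) \<le> e" and t: "0 \<le> t"
  shows "norm (F (history u t) - F (history v t)) \<le> L\<^sub>B * (1 + M * L\<^sub>r) * e"
proof -
  have cont: "continuous_on {-h..t} u" using u(1) by (rule lipschitz_on_continuous_on)
  have M: "0 \<le> M" using u(1) by (rule lipschitz_on_nonneg)
  have hu: "history u t \<in> C_space h H" and hv: "history v t \<in> C_space h H"
    using t history_in_C_space[OF cont u(2)] history_in_C_space[OF v] by auto
  have "sup_norm h (\<lambda>\<theta>. history u t \<theta> - history v t \<theta>) \<le> e"
    using t by (intro sup_norm_le[OF h_pos]) (auto simp: history_def intro!: e)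
  then have "\<bar>r (history u t) - r (history v t)\<bar> \<le> L\<^sub>r * e"
    using r_lipschitz[OF hu hv] L\<^sub>r_nonneg by (meson mult_left_mono order_trans)
  moreover have in_u: "t - r (history u t) \<in> {-h..t}" and in_v: "t - r (history v t) \<in> {-h..t}"
    using r_range[OF hu] r_range[OF hv] t by auto
  moreover have "norm (u (t - r (history u t)) - u (t - r (history v t)))
      \<le> M * \<bar>r (history u t) - r (history v t)\<bar>"
    using lipschitz_on_normD[OF u(1) in_u in_v] by (simp add: abs_minus_commute)
  ultimately have "norm (u (t - r (history u t)) - u (t - r (history v t))) \<le> M * (L\<^sub>r * e)"
    using M by (meson mult_left_mono order_trans)
  then have "norm (u (t - r (history u t)) - v (t - r (history v t))) \<le> M * (L\<^sub>r * e) + e"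
    using e[OF in_v] norm_triangle_mono[of "u (t - r (history u t)) - u (t - r (history v t))" _
        "u (t - r (history v t)) - v (t - r (history v t))"] by simp
  moreover have "norm (F (history u t) - F (history v t))
      \<le> L\<^sub>B * norm (u (t - r (history u t)) - v (t - r (history v t)))"
    unfolding F_history using in_u in_v u(2) v(2) by (intro lipschitz_on_normD[OF B_lipschitz]) blast+
  ultimately have "norm (F (history u t) - F (history v t)) \<le> L\<^sub>B * (M * (L\<^sub>r * e) + e)"
    using L\<^sub>B_nonneg by (meson mult_left_mono order_trans)
  then show ?thesis by (simp add: algebra_simps)
qed

lemma norm_integral_T_diff_le:
  assumes t: "0 \<le> t" "t \<le> \<delta>"
    and I: "((\<lambda>s. T s (f (t - s))) has_integral I) {0..t}" and J: "((\<lambda>s. T s (g (t - s))) has_integral J) {0..t}"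
    and f: "\<And>s. s \<in> {0..t} \<Longrightarrow> f s \<in> H" and g: "\<And>s. s \<in> {0..t} \<Longrightarrow> g s \<in> H"
    and E: "\<And>s. s \<in> {0..t} \<Longrightarrow> norm (f s - g s) \<le> E"
  shows "norm (I - J) \<le> K * E * t"
proof -
  have "norm (I - J) \<le> K * E * (t - 0)"
  proof (rule norm_has_integral_le[OF has_integral_diff[OF I J] t(1)])
    fix s assume s: "0 \<le> s" "s \<le> t"
    then have "T s (f (t - s)) - T s (g (t - s)) = T s (f (t - s) - g (t - s))"
      by (simp add: T_diff f g)
    also have "norm \<dots> \<le> K * norm (f (t - s) - g (t - s))"
      using s t by (intro norm_T_le subspace_diff[OF subspace_H] f g) auto
    also have "\<dots> \<le> K * E"
      using s K_pos by (intro mult_left_mono E) auto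
    finally show "norm (T s (f (t - s)) - T s (g (t - s))) \<le> K * E" .
  qed
  then show ?thesis by simp
qed

section \<open>Existence of a Lipschitz mild solution\<close>

text \<open>
  A contraction argument on \<open>M\<close>-Lipschitz functions with prescribed history. The constants
  are chosen in the order \<open>N\<close> (a bound for the forcing that holds as long as the solution stays within
  distance \<open>1\<close> of its initial value), \<open>M\<close> (large in terms of \<open>N\<close>, \<open>G (\<phi> 0)\<close> and the history), \<open>L\<close> (the Lipschitz constant of the
  forcing along \<open>M\<close>-Lipschitz functions), and at last the time \<open>b\<close>, small in terms of all of them. The last
  inequality is recorded because it also gives uniqueness.
\<close>

lemma lipschitz_mild_solution_exists:
  fixes \<phi> :: "real \<Rightarrow> 'a"
  assumes \<phi>: "M\<^sub>0-lipschitz_on {-h..0} \<phi>" "\<phi> ` {-h..0} \<subseteq> H" "\<phi> 0 \<in> D"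
  obtains u M b where "0 < b" "b \<le> \<delta>" "M-lipschitz_on UNIV u" "range u \<subseteq> H"
    "\<And>s. s \<in> {-h..0} \<Longrightarrow> u s = \<phi> s"
    "\<And>t. t \<in> {0..b} \<Longrightarrow> u t = T t (\<phi> 0) + conv (\<lambda>s. F (history u s)) t"
    "K * (L\<^sub>B * (1 + M * L\<^sub>r)) * b \<le> 1 / 2"
proof -
  have \<phi>_cont: "continuous_on {-h..0} \<phi>" using \<phi>(1) by (rule lipschitz_on_continuous_on)
  then have "bounded (\<phi> ` {-h..0})"
    by (intro compact_imp_bounded compact_continuous_image) auto
  then obtain R where R: "\<And>s. s \<in> {-h..0} \<Longrightarrow> norm (\<phi> s) \<le> R"
    unfolding bounded_iff by blast
  have R0: "0 \<le> R" using R[of 0] h_pos by (auto intro: order_trans[OF norm_ge_zero])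
  have M0: "0 \<le> M\<^sub>0" using \<phi>(1) by (rule lipschitz_on_nonneg)
  define N where "N = norm (B 0) + L\<^sub>B * (R + 1)"
  have N: "0 \<le> N" using L\<^sub>B_nonneg R0 by (simp add: N_def)
  define M where "M = max M\<^sub>0 (K * norm (G (\<phi> 0)) + K * N + 1)"
  have M: "M\<^sub>0 \<le> M" "K * norm (G (\<phi> 0)) + K * N + 1 \<le> M" by (auto simp: M_def)
  have "0 \<le> K * norm (G (\<phi> 0)) + K * N" using K_pos N by simp
  with M have M1: "1 \<le> M" by linarith
  define L where "L = L\<^sub>B * (M * (1 + L\<^sub>r * M))"
  define C where "C = L\<^sub>B * (1 + M * L\<^sub>r)"
  have L: "0 \<le> L" and C: "0 \<le> C" using M1 L\<^sub>B_nonneg L\<^sub>r_nonneg by (simp_all add: L_def C_def)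
  define b where "b = min \<delta> (min (1 / M) (min (1 / (K * L + 1)) (1 / (2 * (K * C + 1)))))"
  have KL: "0 \<le> K * L" "0 \<le> K * C" using K_pos L C by simp_all
  have b_pos: "0 < b" using \<delta>_pos M1 KL by (simp add: b_def)
  have b: "b \<le> \<delta>" "M * b \<le> 1" "K * L * b \<le> 1" "K * C * b \<le> 1 / 2"
  proof -
    show "b \<le> \<delta>" by (simp add: b_def)
    have "M * b \<le> M * (1 / M)" using M1 by (intro mult_left_mono) (auto simp: b_def)
    then show "M * b \<le> 1" using M1 by simp
    have "(K * L + 1) * b \<le> (K * L + 1) * (1 / (K * L + 1))"
      using KL by (intro mult_left_mono) (auto simp: b_def)
    then have "(K * L + 1) * b \<le> 1" using KL by simp
    then show "K * L * b \<le> 1" using b_pos by (simp add: algebra_simps)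
    have "(2 * (K * C + 1)) * b \<le> (2 * (K * C + 1)) * (1 / (2 * (K * C + 1)))"
      using KL by (intro mult_left_mono) (auto simp: b_def)
    then have "(2 * (K * C + 1)) * b \<le> 1" using KL by simp
    then show "K * C * b \<le> 1 / 2" using b_pos by (simp add: algebra_simps)
  qed
  \<comment> \<open>Functions on the whole line, constant outside \<open>{-h..b}\<close>, so that the sup metric of bounded continuous
    functions applies.\<close>
  define X :: "(real \<Rightarrow>\<^sub>C 'a) set" where "X = {u :: real \<Rightarrow>\<^sub>C 'a. M-lipschitz_on UNIV u \<and> (\<forall>s. u s \<in> H) \<and>
    (\<forall>s\<le>0. u s = \<phi> (max (-h) s)) \<and> (\<forall>s. u s = u (min s b))}"
  define \<Phi> where "\<Phi> u s = (if s \<le> 0 then \<phi> (max (-h) s)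
    else T (min s b) (\<phi> 0) + conv (\<lambda>t. F (history u t)) (min s b))" for u s
  have \<phi>0: "\<phi> 0 \<in> H" using \<phi>(3) by (rule D_subset)

  have lip: "M-lipschitz_on A u" and inH: "u ` A \<subseteq> H" and cont: "continuous_on A u"
    if "u \<in> X" for u :: "real \<Rightarrow>\<^sub>C 'a" and A
    using that by (auto simp: X_def intro: lipschitz_on_subset)
  have force_lip: "norm (F (history u t) - F (history u s)) \<le> L * \<bar>t - s\<bar>"
    if "u \<in> X" "s \<in> {0..b}" "t \<in> {0..b}" for u :: "real \<Rightarrow>\<^sub>C 'a" and s t
    unfolding L_def using that by (intro norm_F_history_diff_le lip inH)
  have force_cont: "continuous_on {0..b} (\<lambda>t. F (history u t))" if "u \<in> X" for u :: "real \<Rightarrow>\<^sub>C 'a"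
  proof -
    have "L-lipschitz_on {0..b} (\<lambda>t. F (history u t))"
      using force_lip[OF that] L by (intro lipschitz_onI) (auto simp: dist_norm)
    then show ?thesis by (rule lipschitz_on_continuous_on)
  qed
  have force_in: "(\<lambda>t. F (history u t)) ` {0..b} \<subseteq> H" if "u \<in> X" for u :: "real \<Rightarrow>\<^sub>C 'a"
    using that by (auto intro!: F_history_in cont inH)
  have force_le: "norm (F (history u t)) \<le> N" if u: "u \<in> X" and t: "t \<in> {0..b}" for u :: "real \<Rightarrow>\<^sub>C 'a" and t
  proof -
    let ?x = "t - r (history u t)"
    have x: "?x \<in> {-h..b}"
      using r_range[OF history_in_C_space[OF cont[OF u] inH[OF u]], of t t] t by auto
    have uneg: "norm (u s) \<le> R" if "s \<in> {-h..0}" for s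
    proof -
      have "u s = \<phi> (max (-h) s)" using u that by (simp add: X_def)
      then show ?thesis using R[OF that] that by simp
    qed
    have "norm (u ?x) \<le> R + 1"
    proof (cases "?x \<le> 0")
      case True
      then show ?thesis using uneg[of ?x] x by simp
    next
      case False
      then have "norm (u ?x - u 0) \<le> M * ?x"
        using lipschitz_on_normD[OF lip[OF u, of UNIV], of ?x 0] by simp
      also have "\<dots> \<le> M * b" using x M1 by (intro mult_left_mono) auto
      finally have "norm (u ?x - u 0) \<le> 1" using b by simp
      moreover have "norm (u 0) \<le> R" using uneg[of 0] h_pos by simp
      ultimately show ?thesis using norm_triangle_mono[of "u ?x - u 0" 1 "u 0" R] by simp
    qed
    moreover have "norm (B (u ?x) - B 0) \<le> L\<^sub>B * norm (u ?x - 0)"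
      using inH[OF u, of UNIV] subspace_0[OF subspace_H] by (intro lipschitz_on_normD[OF B_lipschitz]) auto
    ultimately have "norm (B (u ?x) - B 0) \<le> L\<^sub>B * (R + 1)"
      using L\<^sub>B_nonneg by simp (meson mult_left_mono order_trans)
    then show ?thesis
      unfolding F_history N_def using norm_triangle_sub[of "B (u ?x)" "B 0"] by simp
  qed

  have \<Phi>_neg: "\<Phi> u s = \<phi> (max (-h) s)" if "s \<le> 0" for u s
    using that by (simp add: \<Phi>_def)
  have \<Phi>_pos: "\<Phi> u s = T (min s b) (\<phi> 0) + conv (\<lambda>t. F (history u t)) (min s b)" if "0 \<le> s" for u s
    using that b_pos h_pos \<phi>0 by (cases "s = 0") (auto simp: \<Phi>_def T_0)
  have \<Phi>_lip: "M-lipschitz_on UNIV (\<Phi> u)" if u: "u \<in> X" for u :: "real \<Rightarrow>\<^sub>C 'a"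
  proof (rule lipschitz_on_leI)
    have neg: "norm (\<Phi> u t - \<Phi> u s) \<le> M * (t - s)" if "s \<le> t" "t \<le> 0" for s t
    proof -
      have "norm (\<Phi> u t - \<Phi> u s) \<le> M\<^sub>0 * \<bar>max (-h) t - max (-h) s\<bar>"
        using lipschitz_on_normD[OF \<phi>(1), of "max (-h) t" "max (-h) s"] that h_pos by (simp add: \<Phi>_neg)
      also have "\<dots> \<le> M * (t - s)"
        using that M M0 M1 by (intro mult_mono) auto
      finally show ?thesis .
    qed
    have pos: "norm (\<Phi> u t - \<Phi> u s) \<le> M * (t - s)" if st: "0 \<le> s" "s \<le> t" for s t
    proof -
      let ?s = "min s b" and ?t = "min t b" and ?c = "conv (\<lambda>t. F (history u t))"
      have m: "0 \<le> ?s" "?s \<le> ?t" "?t \<le> b" "?t \<le> \<delta>" "?t - ?s \<le> t - s" using st b_pos b(1) by auto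
      have "norm (T ?t (\<phi> 0) - T ?s (\<phi> 0)) \<le> K * norm (G (\<phi> 0)) * (?t - ?s)"
        by (rule norm_T_diff_D_le[OF \<phi>(3) m(1,2,4)])
      moreover have "norm (?c ?t - ?c ?s) \<le> (K * L * b + K * N) * (?t - ?s)"
        by (rule norm_conv_diff_le[OF force_cont[OF u] force_in[OF u] b(1) force_lip[OF u] force_le[OF u] m(1,2,3)])
      ultimately have "norm ((T ?t (\<phi> 0) - T ?s (\<phi> 0)) + (?c ?t - ?c ?s))
          \<le> K * norm (G (\<phi> 0)) * (?t - ?s) + (K * L * b + K * N) * (?t - ?s)"
        by (rule norm_triangle_mono)
      also have "\<dots> = (K * norm (G (\<phi> 0)) + K * L * b + K * N) * (?t - ?s)"
        by (simp only: distrib_right add.assoc)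
      also have "\<dots> \<le> M * (?t - ?s)"
        using M(2) b(3) m by (intro mult_right_mono) auto
      also have "\<dots> \<le> M * (t - s)"
        using m M1 by (intro mult_left_mono) auto
      finally show ?thesis using st by (simp add: \<Phi>_pos algebra_simps)
    qed
    fix s t :: real assume "s \<le> t"
    then consider "t \<le> 0" | "0 \<le> s" | "s \<le> 0" "0 \<le> t" by linarith
    then have "norm (\<Phi> u t - \<Phi> u s) \<le> M * (t - s)"
    proof cases
      case 3
      then have "norm ((\<Phi> u t - \<Phi> u 0) + (\<Phi> u 0 - \<Phi> u s)) \<le> M * (t - 0) + M * (0 - s)"
        by (intro norm_triangle_mono pos neg) auto
      then show ?thesis by (simp add: algebra_simps)
    qed (use \<open>s \<le> t\<close> pos neg in auto)
    then show "dist (\<Phi> u s) (\<Phi> u t) \<le> M * dist s t"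
      using \<open>s \<le> t\<close> by (simp add: dist_norm norm_minus_commute)
  qed (use M1 in auto)
  have \<Phi>_in: "\<Phi> u s \<in> H" if u: "u \<in> X" for u :: "real \<Rightarrow>\<^sub>C 'a" and s
  proof (cases "s \<le> 0")
    case True
    then show ?thesis using \<phi>(2) h_pos by (auto simp: \<Phi>_neg)
  next
    case False
    then show ?thesis using b b_pos \<phi>0
      by (auto simp: \<Phi>_pos intro!: subspace_add[OF subspace_H] T_in conv_in[OF force_cont[OF u] force_in[OF u]])
  qed
  have \<Phi>_min: "\<Phi> u s = \<Phi> u (min s b)" for u s
    using b_pos by (cases "s \<le> 0") (auto simp: \<Phi>_neg \<Phi>_pos min_def)
  have bcont: "g \<in> bcontfun"
    if "M-lipschitz_on UNIV g" "\<And>s. s \<le> 0 \<Longrightarrow> g s = g (max (-h) s)" "\<And>s. g s = g (min s b)" for g :: "real \<Rightarrow> 'a"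
  proof -
    have "bounded (g ` {-h..b})"
      by (intro compact_imp_bounded compact_continuous_image
          lipschitz_on_continuous_on[OF lipschitz_on_subset[OF that(1)]]) auto
    moreover have "range g \<subseteq> g ` {-h..b}"
    proof (clarify, cases)
      fix s :: real assume "s \<le> 0"
      then show "g s \<in> g ` {-h..b}"
        using that(2)[of s] h_pos b_pos by (intro image_eqI[of _ _ "max (-h) s"]) auto
    next
      fix s :: real assume "\<not> s \<le> 0"
      then show "g s \<in> g ` {-h..b}"
        using that(3)[of s] h_pos b_pos by (intro image_eqI[of _ _ "min s b"]) auto
    qed
    ultimately show ?thesis
      using that(1) by (auto simp: bcontfun_def intro: bounded_subset lipschitz_on_continuous_on)
  qed
  define \<Psi> where "\<Psi> u = Bcontfun (\<Phi> (apply_bcontfun u))" for u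
  have \<Psi>: "apply_bcontfun (\<Psi> u) = \<Phi> u" if "u \<in> X" for u
    unfolding \<Psi>_def using h_pos
    by (intro Bcontfun_inverse bcont \<Phi>_lip that \<Phi>_min) (simp add: \<Phi>_neg)

  have "\<exists>!u\<in>X. \<Psi> u = u"
  proof (rule Banach_fix[where c = "1 / 2"])
    have "closed X"
      unfolding X_def lipschitz_on_def ball_UNIV
      by (intro closed_Collect_conj closed_Collect_all closed_Collect_imp open_Collect_const
          closed_Collect_le closed_Collect_eq closed_Collect_const continuous_intros continuous_on_bcontfun_eval)
        (use closed_vimage[OF closed_H continuous_on_bcontfun_eval] in \<open>auto simp: vimage_def\<close>)
    then show "complete X" by (simp add: complete_eq_closed)
    let ?g = "\<lambda>s. \<phi> (max (-h) (min s 0))"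
    have g: "M-lipschitz_on UNIV ?g"
    proof (rule lipschitz_onI)
      fix s t :: real
      have "dist (?g s) (?g t) \<le> M\<^sub>0 * dist (max (-h) (min s 0)) (max (-h) (min t 0))"
        using h_pos by (intro lipschitz_onD[OF \<phi>(1)]) auto
      also have "\<dots> \<le> M * dist s t"
        using M(1) M0 M1 by (intro mult_mono) (auto simp: dist_real_def)
      finally show "dist (?g s) (?g t) \<le> M * dist s t" .
    qed (use M1 in auto)
    have "?g \<in> bcontfun"
      using b_pos h_pos by (intro bcont g) (auto simp: min_def max_def)
    then have "apply_bcontfun (Bcontfun ?g) = ?g" by (rule Bcontfun_inverse)
    then have "Bcontfun ?g \<in> X"
      using g \<phi>(2) b_pos h_pos by (auto simp: X_def min_def)
    then show "X \<noteq> {}" by blast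
    show "\<Psi> ` X \<subseteq> X"
      using \<Phi>_lip \<Phi>_in \<Phi>_neg \<Phi>_min by (auto simp: X_def[of] \<Psi>)
    show "dist (\<Psi> u) (\<Psi> v) \<le> 1 / 2 * dist u v" if u: "u \<in> X" and v: "v \<in> X" for u v
    proof (rule dist_bound)
      fix s
      show "dist (\<Psi> u s) (\<Psi> v s) \<le> 1 / 2 * dist u v"
      proof (cases "s \<le> 0")
        case True
        then show ?thesis using u v by (simp add: \<Psi> \<Phi>_neg)
      next
        case False
        let ?s = "min s b"
        have s: "0 \<le> ?s" "?s \<le> b" "?s \<le> \<delta>" using False b_pos b(1) by auto
        have "norm (conv (\<lambda>t. F (history u t)) ?s - conv (\<lambda>t. F (history v t)) ?s) \<le> K * (C * dist u v) * ?s"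
        proof (rule norm_integral_T_diff_le[OF s(1,3)])
          show "((\<lambda>\<tau>. T \<tau> (F (history u (?s - \<tau>)))) has_integral conv (\<lambda>t. F (history u t)) ?s) {0..?s}"
            unfolding conv_def using s b by (intro conv_integrand_has_integral[OF force_cont[OF u] force_in[OF u]]) auto
          show "((\<lambda>\<tau>. T \<tau> (F (history v (?s - \<tau>)))) has_integral conv (\<lambda>t. F (history v t)) ?s) {0..?s}"
            unfolding conv_def using s b by (intro conv_integrand_has_integral[OF force_cont[OF v] force_in[OF v]]) auto
          fix t assume t: "t \<in> {0..?s}"
          then show "F (history u t) \<in> H" "F (history v t) \<in> H"
            using force_in[OF u] force_in[OF v] by auto
          show "norm (F (history u t) - F (history v t)) \<le> C * dist u v"
            unfolding C_def using t u v dist_bounded[of u _ v]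
            by (intro norm_F_history_compare lip inH cont) (auto simp: dist_norm)
        qed
        also have "\<dots> \<le> K * (C * dist u v) * b"
          using s K_pos C by (intro mult_left_mono) auto
        also have "\<dots> = (K * C * b) * dist u v" by simp
        also have "\<dots> \<le> 1 / 2 * dist u v"
          using b(4) by (intro mult_right_mono) auto
        finally show ?thesis using False u v by (simp add: \<Psi> \<Phi>_pos dist_norm)
      qed
    qed
  qed auto
  then obtain u where u: "u \<in> X" "\<Psi> u = u" by blast
  then have fix_u: "apply_bcontfun u = \<Phi> u" using \<Psi>[OF u(1)] by simp
  show ?thesis
  proof (rule that[OF b_pos b(1) lip[OF u(1)]])
    show "range u \<subseteq> H" by (rule inH[OF u(1)])
    show "u s = \<phi> s" if "s \<in> {-h..0}" for s
      using that by (subst fix_u) (simp add: \<Phi>_neg)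
    show "u t = T t (\<phi> 0) + conv (\<lambda>s. F (history u s)) t" if "t \<in> {0..b}" for t
      using that by (subst fix_u) (simp add: \<Phi>_pos)
    show "K * (L\<^sub>B * (1 + M * L\<^sub>r)) * b \<le> 1 / 2"
      using b(4) by (simp add: C_def)
  qed
qed

section \<open>Classical solutions of the delay equation\<close>

text \<open>
  The solution is Lipschitz, hence so is its forcing term, and the smoothing estimate makes the Duhamel
  integral of a Lipschitz function strongly differentiable.
\<close>

lemma mild_imp_classical:
  assumes b: "0 < b" "b \<le> \<delta>"
    and u: "M-lipschitz_on UNIV u" "range u \<subseteq> H" "\<And>s. s \<in> {-h..0} \<Longrightarrow> u s = \<phi> s"
    and \<phi>: "\<phi> 0 \<in> D"
    and mild: "\<And>t. t \<in> {0..b} \<Longrightarrow> u t = T t (\<phi> 0) + conv (\<lambda>s. F (history u s)) t"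
  shows "classical_solution h H D (\<lambda>x. - G x) F \<phi> b u"
proof -
  let ?f = "\<lambda>t. F (history u t)"
  have u_cont: "continuous_on A u" and uA: "u ` A \<subseteq> H" and u_lip: "M-lipschitz_on A u" for A
    using u(1,2) by (auto intro: lipschitz_on_subset continuous_on_subset[OF lipschitz_on_continuous_on])
  define L where "L = L\<^sub>B * (M * (1 + L\<^sub>r * M))"
  have f_lip: "norm (?f t - ?f s) \<le> L * \<bar>t - s\<bar>" if "s \<in> {0..b}" "t \<in> {0..b}" for s t
    unfolding L_def using that by (intro norm_F_history_diff_le u_lip uA)
  have "0 \<le> L"
    unfolding L_def using L\<^sub>B_nonneg L\<^sub>r_nonneg lipschitz_on_nonneg[OF u(1)] by simp
  then have "L-lipschitz_on {0..b} ?f"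
    using f_lip by (intro lipschitz_onI) (auto simp: dist_norm)
  then have f: "continuous_on {0..b} ?f" by (rule lipschitz_on_continuous_on)
  have fH: "?f ` {0..b} \<subseteq> H"
    by (auto intro!: F_history_in u_cont uA)
  have conv_cont: "continuous_on {0..b} (conv ?f)"
  proof -
    have "continuous_on {0..b} (\<lambda>t. u t - T t (\<phi> 0))"
      using b by (intro continuous_intros u_cont continuous_on_subset[OF continuous_on_T[OF D_subset[OF \<phi>]]]) auto
    then show ?thesis
      by (rule continuous_on_eq) (simp add: mild)
  qed
  have conv_D: "conv ?f t \<in> D" if "0 < t" "t \<le> b" for t
    by (rule conv_in_D[OF f fH b(2) f_lip conv_cont that])
  have uD: "u t \<in> D" and Gu: "G (u t) = T t (G (\<phi> 0)) + G (conv ?f t)" if t: "0 < t" "t < b" for t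
  proof -
    have "T t (\<phi> 0) \<in> D" using t b \<phi> by (intro T_in_D D_subset) auto
    moreover have "G (T t (\<phi> 0)) = T t (G (\<phi> 0))" using t b by (intro G_T_commute \<phi>) auto
    ultimately show "u t \<in> D" "G (u t) = T t (G (\<phi> 0)) + G (conv ?f t)"
      using t conv_D[of t] by (simp_all add: mild G_add)
  qed
  have "continuous_on {0<..<b} (\<lambda>t. T t (G (\<phi> 0)) + G (conv ?f t))"
    using b by (intro continuous_on_add continuous_on_G_conv[OF f fH b(2) f_lip conv_cont]
        continuous_on_subset[OF continuous_on_T[OF G_in[OF \<phi>]]]) auto
  then have Gu_cont: "continuous_on {0<..<b} (\<lambda>t. G (u t))"
    by (rule continuous_on_eq) (simp add: Gu)
  have der: "(u has_vector_derivative G (u t) + ?f t) (at t)" if t: "0 < t" "t < b" for t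
  proof (rule mild_has_vector_derivative[OF f fH b(2) _ uD Gu_cont t])
    fix p q assume pq: "0 < p" "p \<le> q" "q < b"
    have "T q (\<phi> 0) = T (q - p) (T p (\<phi> 0))"
      using T_plus[of "q - p" p "\<phi> 0"] pq D_subset[OF \<phi>] by simp
    moreover have "conv ?f q = T (q - p) (conv ?f p) + integral {0..q - p} (\<lambda>s. T s (?f (q - s)))"
      using pq b by (intro conv_split[OF f fH]) auto
    moreover have "T (q - p) (T p (\<phi> 0) + conv ?f p) = T (q - p) (T p (\<phi> 0)) + T (q - p) (conv ?f p)"
      using pq b \<phi> by (intro T_add T_in conv_in[OF f fH] D_subset) auto
    ultimately show "u q = T (q - p) (u p) + integral {0..q - p} (\<lambda>s. T s (?f (q - s)))"
      using pq by (simp add: mild)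
  qed
  have "continuous_on {0<..<b} (\<lambda>t. G (u t) + ?f t)"
    by (intro continuous_on_add Gu_cont continuous_on_subset[OF f]) auto
  then have "u C1_differentiable_on {0<..<b}"
    unfolding C1_differentiable_on_def using der by (intro exI[of _ "\<lambda>t. G (u t) + ?f t"]) auto
  moreover have "vector_derivative u (at t) + - G (u t) = ?f t" if "0 < t" "t < b" for t
    using vector_derivative_at[OF der[OF that]] by simp
  ultimately show ?thesis
    unfolding classical_solution_def using uA u_cont u(3) uD by auto
qed

text \<open>
  A competing classical solution \<open>v\<close> is only known to be continuous at time \<open>0\<close>. It satisfies the variation of
  constants formula, and \<open>norm_F_history_compare\<close> asks for a Lipschitz bound on \<open>u\<close> only. Over \<open>{-h..t}\<close> the largest
  distance between \<open>u\<close> and \<open>v\<close> is then at most half of itself.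
\<close>

lemma classical_solution_eq:
  assumes b: "0 < b" "b \<le> \<delta>"
    and u: "M-lipschitz_on UNIV u" "range u \<subseteq> H" "\<And>s. s \<in> {-h..0} \<Longrightarrow> u s = \<phi> s"
    and \<phi>: "\<phi> 0 \<in> D"
    and mild: "\<And>t. t \<in> {0..b} \<Longrightarrow> u t = T t (\<phi> 0) + conv (\<lambda>s. F (history u s)) t"
    and small: "K * (L\<^sub>B * (1 + M * L\<^sub>r)) * b \<le> 1 / 2"
    and v: "classical_solution h H D (\<lambda>x. - G x) F \<phi> b v"
    and t: "t \<in> {-h..<b}"
  shows "v t = u t"
proof (cases "t \<le> 0")
  case True
  then show ?thesis
    using v u(3)[of t] t by (auto simp: classical_solution_def)
next
  case False
  have u_cont: "continuous_on A u" and uA: "u ` A \<subseteq> H" and u_lip: "M-lipschitz_on A u" for A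
    using u(1,2) by (auto intro: lipschitz_on_subset continuous_on_subset[OF lipschitz_on_continuous_on])
  have v_cont: "continuous_on {-h..s} v" and vA: "v ` {-h..s} \<subseteq> H" if "s < b" for s
    using v that by (auto simp: classical_solution_def elim: continuous_on_subset)
  have v\<phi>: "v s = \<phi> s" if "s \<in> {-h..0}" for s
    using v that by (simp add: classical_solution_def)
  have v_mild: "((\<lambda>\<tau>. T \<tau> (F (history v (s - \<tau>)))) has_integral v s - T s (\<phi> 0)) {0..s}"
    if s: "0 \<le> s" "s < b" for s
  proof -
    have "((\<lambda>\<tau>. T \<tau> (F (history v (s - \<tau>)))) has_integral v s - T s (v 0)) {0..s}"
    proof (rule classical_imp_mild[OF s(1)])
      show "continuous_on {0..s} v" "v ` {0..s} \<subseteq> H"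
        using continuous_on_subset[OF v_cont[OF s(2)], of "{0..s}"] vA[OF s(2)] h_pos by auto
      fix \<tau> assume \<tau>: "0 < \<tau>" "\<tau> < s"
      then have \<tau>b: "\<tau> \<in> {0<..<b}" using s by auto
      show "v \<tau> \<in> D" using v \<tau>b by (simp add: classical_solution_def)
      show "F (history v \<tau>) \<in> H"
        using \<tau> s by (intro F_history_in v_cont vA) auto
      have "(v has_vector_derivative vector_derivative v (at \<tau>)) (at \<tau>)"
        using v \<tau>b by (auto simp: classical_solution_def C1_differentiable_on_eq vector_derivative_works)
      moreover have "vector_derivative v (at \<tau>) = G (v \<tau>) + F (history v \<tau>)"
        using v \<tau>b by (auto simp: classical_solution_def algebra_simps)
      ultimately show "(v has_vector_derivative G (v \<tau>) + F (history v \<tau>)) (at \<tau>)" by simp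
    qed (use s b in auto)
    then show ?thesis using v\<phi>[of 0] h_pos by simp
  qed
  have t: "0 < t" "t < b" using False t by auto
  have "continuous_on {-h..t} (\<lambda>s. norm (u s - v s))"
    by (intro continuous_intros u_cont v_cont t)
  then obtain s where s: "s \<in> {-h..t}" and max: "\<And>s'. s' \<in> {-h..t} \<Longrightarrow> norm (u s' - v s') \<le> norm (u s - v s)"
    using continuous_attains_sup[of "{-h..t}" "\<lambda>s. norm (u s - v s)"] h_pos t by auto
  define e where "e = norm (u s - v s)"
  have "e \<le> e / 2"
  proof (cases "s \<le> 0")
    case True
    then show ?thesis using s u(3)[of s] v\<phi>[of s] by (simp add: e_def)
  next
    case False
    then have s': "0 \<le> s" "s < b" "s \<le> \<delta>" using s t b by auto
    have "norm (conv (\<lambda>s. F (history u s)) s - (v s - T s (\<phi> 0))) \<le> K * (L\<^sub>B * (1 + M * L\<^sub>r) * e) * s"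
    proof (rule norm_integral_T_diff_le[OF s'(1,3) _ v_mild[OF s'(1,2)]])
      have "continuous_on {0..b} (\<lambda>t. F (history u t))"
      proof -
        have "(L\<^sub>B * (M * (1 + L\<^sub>r * M)))-lipschitz_on {0..b} (\<lambda>t. F (history u t))"
          using norm_F_history_diff_le[OF u_lip uA, of _ b] L\<^sub>B_nonneg L\<^sub>r_nonneg lipschitz_on_nonneg[OF u(1)]
          by (intro lipschitz_onI) (auto simp: dist_norm)
        then show ?thesis by (rule lipschitz_on_continuous_on)
      qed
      moreover have "(\<lambda>t. F (history u t)) ` {0..b} \<subseteq> H"
        by (auto intro!: F_history_in u_cont uA)
      ultimately show "((\<lambda>\<tau>. T \<tau> (F (history u (s - \<tau>)))) has_integral conv (\<lambda>s. F (history u s)) s) {0..s}"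
        unfolding conv_def using s' b by (intro conv_integrand_has_integral[of b]) auto
      fix \<tau> assume \<tau>: "\<tau> \<in> {0..s}"
      then show "F (history u \<tau>) \<in> H" "F (history v \<tau>) \<in> H"
        using s' by (auto intro!: F_history_in u_cont uA v_cont vA)
      show "norm (F (history u \<tau>) - F (history v \<tau>)) \<le> L\<^sub>B * (1 + M * L\<^sub>r) * e"
        using \<tau> s s' max unfolding e_def
        by (intro norm_F_history_compare u_lip uA v_cont vA) auto
    qed
    also have "\<dots> \<le> K * (L\<^sub>B * (1 + M * L\<^sub>r) * e) * b"
      using s' K_pos L\<^sub>B_nonneg L\<^sub>r_nonneg lipschitz_on_nonneg[OF u(1)]
      by (intro mult_left_mono) (auto simp: e_def)
    also have "\<dots> = K * (L\<^sub>B * (1 + M * L\<^sub>r)) * b * e"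
      by (simp add: mult_ac)
    also have "\<dots> \<le> 1 / 2 * e"
      by (intro mult_right_mono small) (simp add: e_def)
    finally have "norm (u s - v s) \<le> 1 / 2 * e"
      using s' by (simp add: mild algebra_simps)
    then show ?thesis by (simp add: e_def)
  qed
  then have "norm (u t - v t) \<le> 0"
    using max[of t] t h_pos by (simp add: e_def)
  then show ?thesis by simp
qed

text \<open>
  The \<open>C\<^sup>1\<close> condition on the history serves to make it Lipschitz; the condition \<open>\<phi> 0 \<in> D\<close> makes the orbit
  \<open>T t (\<phi> 0)\<close> Lipschitz up to time \<open>0\<close>.
\<close>

theorem local_classical_solution:
  assumes \<phi>: "\<phi> \<in> C1_space h H" "\<phi> 0 \<in> D"
  shows "\<exists>b>0. \<exists>u. classical_solution h H D (\<lambda>x. - G x) F \<phi> b u \<and>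
    (\<forall>v. classical_solution h H D (\<lambda>x. - G x) F \<phi> b v \<longrightarrow> (\<forall>t\<in>{-h..<b}. v t = u t))"
proof -
  obtain \<phi>' where "continuous_on {-h..0} \<phi>'"
    "\<And>s. s \<in> {-h..0} \<Longrightarrow> (\<phi> has_vector_derivative \<phi>' s) (at s within {-h..0})"
    using \<phi>(1) by (auto simp: C1_space_def)
  then obtain M\<^sub>0 where M0: "M\<^sub>0-lipschitz_on {-h..0} \<phi>"
    using lipschitz_on_C1_interval by blast
  have \<phi>H: "\<phi> ` {-h..0} \<subseteq> H"
    using \<phi>(1) by (simp add: C1_space_def C_space_def)
  obtain u M b where *: "0 < b" "b \<le> \<delta>" "M-lipschitz_on UNIV u" "range u \<subseteq> H"
    "\<And>s. s \<in> {-h..0} \<Longrightarrow> u s = \<phi> s"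
    and mild: "\<And>t. t \<in> {0..b} \<Longrightarrow> u t = T t (\<phi> 0) + conv (\<lambda>s. F (history u s)) t"
    and small: "K * (L\<^sub>B * (1 + M * L\<^sub>r)) * b \<le> 1 / 2"
    by (rule lipschitz_mild_solution_exists[OF M0 \<phi>H \<phi>(2)], rule that, assumption+)
  show ?thesis
  proof (intro exI conjI allI impI ballI)
    show "0 < b" by fact
    show "classical_solution h H D (\<lambda>x. - G x) F \<phi> b u"
      by (rule mild_imp_classical[OF * \<phi>(2) mild])
    show "v t = u t" if "classical_solution h H D (\<lambda>x. - G x) F \<phi> b v" "t \<in> {-h..<b}" for v t
      by (rule classical_solution_eq[OF * \<phi>(2) mild small that])
  qed
qed

end

theorem theorem2:
  fixes \<Omega> :: "(real ^ 'n) set"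
    and H D :: "(real ^ 'n) l2 set"
    and T :: "real \<Rightarrow> (real ^ 'n) l2 \<Rightarrow> (real ^ 'n) l2"
    and A B :: "(real ^ 'n) l2 \<Rightarrow> (real ^ 'n) l2"
    and r :: "(real \<Rightarrow> (real ^ 'n) l2) \<Rightarrow> real"
    and h :: real
  assumes domain: "open \<Omega>" "connected \<Omega>" "\<Omega> \<noteq> {}"
    and h: "h > 0"
    and H: "H = L2_complex \<Omega> \<or> H = L2_real \<Omega>"
    and semigroup: "C0_semigroup_on H T" "compact_semigroup_on H T" "analytic_semigroup_on H T"
    and generator: "is_generator H T D (\<lambda>x. - A x)"
    and B: "B ` H \<subseteq> H" "maps_bounded_sets_on H B" "\<exists>L. L-lipschitz_on H B"
    and r: "\<And>\<phi>. \<phi> \<in> C_space h H \<Longrightarrow> r \<phi> \<in> {0..h}" "lipschitz_functional h H r"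
  shows "\<forall>\<phi>. \<phi> \<in> C1_space h H \<and> \<phi> 0 \<in> D \<longrightarrow>
    (\<exists>t\<^sub>\<phi>>0.
       (\<exists>u. classical_solution h H D A (delay_rhs B r) \<phi> t\<^sub>\<phi> u) \<and>
       (\<forall>u v. classical_solution h H D A (delay_rhs B r) \<phi> t\<^sub>\<phi> u \<longrightarrow>
              classical_solution h H D A (delay_rhs B r) \<phi> t\<^sub>\<phi> v \<longrightarrow>
              (\<forall>t\<in>{-h..<t\<^sub>\<phi>}. u t = v t)))"
proof -
  have "\<Omega> \<in> sets lebesgue"
    using domain(1) by (simp add: borel_open sets_completionI_sets)
  then have sub: "subspace H" and closed: "closed H"
    using H subspace_L2_complex[of \<Omega>] closed_L2_complex[of \<Omega>] subspace_real_valued closed_real_valued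
    by (auto simp: L2_real_eq intro: subspace_inter)
  obtain \<delta> K where \<delta>: "0 < \<delta>" and K: "0 < K"
    and bound: "\<And>t x. 0 \<le> t \<Longrightarrow> t \<le> \<delta> \<Longrightarrow> x \<in> H \<Longrightarrow> norm (T t x) \<le> K * norm x"
    and smooth: "\<And>t x. 0 < t \<Longrightarrow> t \<le> \<delta> \<Longrightarrow> x \<in> H \<Longrightarrow>
      T t x \<in> D \<and> ((\<lambda>s. T s x) has_vector_derivative - A (T t x)) (at t) \<and> norm (- A (T t x)) \<le> K / t * norm x"
    using analytic_semigroup_smoothing[OF sub closed semigroup(1,3) generator] by blast
  obtain L\<^sub>B where LB: "L\<^sub>B-lipschitz_on H B" using B(3) ..
  obtain L\<^sub>r where Lr: "0 \<le> L\<^sub>r" "\<forall>\<phi>\<in>C_space h H. \<forall>\<psi>\<in>C_space h H.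
      \<bar>r \<phi> - r \<psi>\<bar> \<le> L\<^sub>r * sup_norm h (\<lambda>s. \<phi> s - \<psi> s)"
    using r(2) unfolding lipschitz_functional_def by blast
  interpret delay_equation H T D "\<lambda>x. - A x" \<delta> K B r h L\<^sub>B L\<^sub>r
    by unfold_locales (use sub closed semigroup(1) generator \<delta> K bound smooth h B(1) LB r(1) Lr in auto)
  show ?thesis
  proof (intro allI impI)
    fix \<phi> assume "\<phi> \<in> C1_space h H \<and> \<phi> 0 \<in> D"
    then obtain b u where b: "b > 0" "classical_solution h H D (\<lambda>x. - (- A x)) (delay_rhs B r) \<phi> b u"
      and "\<forall>v. classical_solution h H D (\<lambda>x. - (- A x)) (delay_rhs B r) \<phi> b v \<longrightarrow>
        (\<forall>t\<in>{-h..<b}. v t = u t)"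
      using local_classical_solution[of \<phi>] by blast
    then have u: "classical_solution h H D A (delay_rhs B r) \<phi> b u"
      and uniq: "\<And>v t. classical_solution h H D A (delay_rhs B r) \<phi> b v \<Longrightarrow> t \<in> {-h..<b} \<Longrightarrow> v t = u t"
      by simp_all
    show "\<exists>t\<^sub>\<phi>>0. (\<exists>u. classical_solution h H D A (delay_rhs B r) \<phi> t\<^sub>\<phi> u) \<and>
       (\<forall>u v. classical_solution h H D A (delay_rhs B r) \<phi> t\<^sub>\<phi> u \<longrightarrow>
              classical_solution h H D A (delay_rhs B r) \<phi> t\<^sub>\<phi> v \<longrightarrow>
              (\<forall>t\<in>{-h..<t\<^sub>\<phi>}. u t = v t))"
    proof (intro exI[of _ b] conjI allI impI ballI)
      show "\<exists>u. classical_solution h H D A (delay_rhs B r) \<phi> b u"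
        using u by blast
      show "v t = w t" if "classical_solution h H D A (delay_rhs B r) \<phi> b v"
        "classical_solution h H D A (delay_rhs B r) \<phi> b w" "t \<in> {-h..<b}" for v w t
        using uniq[OF that(1,3)] uniq[OF that(2,3)] by simp
    qed fact
  qed
qed

end
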